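(* Let $n\ge 3$, let $K$ be a field, let $X=(x_{ij})_{1\le i,j\le n}$ and $Y=(y_{ij})_{1\le i,j\le n}$ be matrices of independent indeterminates over $K$, let $R=K[X,Y]$ be the polynomial ring in all these $2n^2$ variables, and let $C=XY-YX=(c_{ij})$. Let $\mathcal{I}$ be the ideal of $R$ generated by all diagonal entries $c_{ii}$ and all anti-diagonal entries $c_{i,n+1-i}$ ($1\le i\le n$) of $C$. Then $\mathcal{I}$ is generated by a regular sequence, that is, $R/\mathcal{I}$ is a complete intersection, and its dimension is $2n^2-2n+2$ when $n$ is odd and $2n^2-2n+1$ when $n$ is even.
   Context: Dimension means Krull dimension. *)

theory Defs
  imports
    "HOL-Algebra.QuotRing"
    "HOL-Library.Poly_Mapping"
    "HOL-Library.Extended_Nat"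
    "Jordan_Normal_Form.Matrix"
begin

section \<open>Polynomial rings in a set of indeterminates\<close>

text \<open>A monomial is a finitely supported exponent function on the indeterminates, a polynomial
  is a finitely supported coefficient function on the monomials; multiplication of such
  polynomials is the convolution product provided by the library.\<close>

type_synonym ('v, 'k) mpoly = "('v \<Rightarrow>\<^sub>0 nat) \<Rightarrow>\<^sub>0 'k"

definition indet :: "'v \<Rightarrow> ('v, 'k::comm_ring_1) mpoly" where
  "indet v = Poly_Mapping.single (Poly_Mapping.single v 1) 1"

text \<open>The ring \<open>K[V]\<close>. The type \<open>'v\<close> may contain more indeterminates than those in \<open>V\<close>, hence
  the restriction of the carrier.\<close>

definition poly_ring :: "'v set \<Rightarrow> ('v, 'k::comm_ring_1) mpoly ring" where
  "poly_ring V =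
    \<lparr>carrier = {p. \<forall>m\<in>Poly_Mapping.keys p. Poly_Mapping.keys m \<subseteq> V},
     monoid.mult = (*), one = 1, zero = 0, add = (+)\<rparr>"

lemma poly_ring_cring: "cring (poly_ring V :: ('v, 'k::comm_ring_1) mpoly ring)"
proof -
  let ?C = "{p :: ('v, 'k) mpoly. \<forall>m\<in>Poly_Mapping.keys p. Poly_Mapping.keys m \<subseteq> V}"
  have add: "p + q \<in> ?C" if "p \<in> ?C" "q \<in> ?C" for p q
    using that Poly_Mapping.keys_add[of p q] by blast
  have mult: "p * q \<in> ?C" if "p \<in> ?C" "q \<in> ?C" for p q
  proof (intro CollectI ballI)
    fix m assume "m \<in> Poly_Mapping.keys (p * q)"
    then obtain a b where "m = a + b" "a \<in> Poly_Mapping.keys p" "b \<in> Poly_Mapping.keys q"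
      using keys_mult[of p q] by blast
    then show "Poly_Mapping.keys m \<subseteq> V"
      using that Poly_Mapping.keys_add[of a b] by blast
  qed
  have uminus: "- p \<in> ?C" if "p \<in> ?C" for p
    using that by simp
  have one: "1 \<in> ?C"
    by simp
  have inverse: "\<exists>q\<in>?C. q + p = 0" if "p \<in> ?C" for p
    by (rule bexI[of _ "- p"]) (use uminus[OF that] in simp_all)
  show ?thesis
  proof (rule cringI)
    show "abelian_group (poly_ring V :: ('v, 'k) mpoly ring)"
      unfolding poly_ring_def
      by (rule abelian_groupI; simp only: ring_record_simps)
        ((rule add add.assoc add.commute add.left_neutral inverse; assumption?) | simp)+
    show "comm_monoid (poly_ring V :: ('v, 'k) mpoly ring)"
      unfolding poly_ring_def
      by (rule comm_monoidI; simp only: ring_record_simps)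
        ((rule mult one mult.assoc mult.commute mult_1_left; assumption?) | simp)+
  qed (simp add: poly_ring_def distrib_right)
qed

section \<open>Regular sequences and Krull dimension\<close>

definition nonzerodivisor :: "('a, 'b) ring_scheme \<Rightarrow> 'a \<Rightarrow> bool" where
  "nonzerodivisor Q a \<longleftrightarrow>
    a \<in> carrier Q \<and> (\<forall>y\<in>carrier Q. a \<otimes>\<^bsub>Q\<^esub> y = \<zero>\<^bsub>Q\<^esub> \<longrightarrow> y = \<zero>\<^bsub>Q\<^esub>)"

text \<open>\<open>f\<^sub>1, \<dots>, f\<^sub>r\<close> is regular if each \<open>f\<^sub>i\<close> is a nonzerodivisor on
  \<open>R / (f\<^sub>1, \<dots>, f\<^bsub>i-1\<^esub>)\<close> and \<open>(f\<^sub>1, \<dots>, f\<^sub>r) \<noteq> R\<close>.\<close>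

definition regular_sequence :: "('a, 'b) ring_scheme \<Rightarrow> 'a list \<Rightarrow> bool" where
  "regular_sequence R fs \<longleftrightarrow>
    set fs \<subseteq> carrier R \<and>
    (\<forall>i<length fs. nonzerodivisor (R Quot (Idl\<^bsub>R\<^esub> (set (take i fs))))
                      ((Idl\<^bsub>R\<^esub> (set (take i fs))) +>\<^bsub>R\<^esub> (fs ! i))) \<and>
    Idl\<^bsub>R\<^esub> (set fs) \<noteq> carrier R"

text \<open>The supremum of the lengths \<open>r\<close> of chains \<open>P\<^sub>0 \<subset> \<dots> \<subset> P\<^sub>r\<close> of prime ideals. The value on the
  zero ring, which has no prime ideals, is \<open>0\<close> here.\<close>

definition krull_dim :: "('a, 'b) ring_scheme \<Rightarrow> enat" where
  "krull_dim R =
    (SUP Ps \<in> {Ps. Ps \<noteq> [] \<and> (\<forall>P\<in>set Ps. primeideal P R) \<and> sorted_wrt (\<subset>) Ps}.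
       enat (length Ps - 1))"

section \<open>The entries of two generic matrices\<close>

datatype entry = X_entry nat nat | Y_entry nat nat

text \<open>Rows and columns of matrices are numbered from \<open>0\<close> to \<open>n - 1\<close>, so the anti-diagonal
  positions are \<open>(i, n - 1 - i)\<close>.\<close>

definition entries :: "nat \<Rightarrow> entry set" where
  "entries n = {X_entry i j | i j. i < n \<and> j < n} \<union> {Y_entry i j | i j. i < n \<and> j < n}"

definition generic_X :: "nat \<Rightarrow> (entry, 'k::comm_ring_1) mpoly mat" where
  "generic_X n = mat n n (\<lambda>(i, j). indet (X_entry i j))"

definition generic_Y :: "nat \<Rightarrow> (entry, 'k::comm_ring_1) mpoly mat" where
  "generic_Y n = mat n n (\<lambda>(i, j). indet (Y_entry i j))"

end

theory Submission
  imports Defs "Jordan_Normal_Form.Determinant"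
begin

text \<open>Let \<open>N = 2 n\<^sup>2\<close> be the number of indeterminates. The trace of a commutator is zero, so the generator
  \<open>c\<^sub>0\<^sub>0\<close> is redundant; the others, listed without repetition at the positions \<open>equations n\<close>, are
  \<open>r = 2 n - 2\<close> (\<open>n\<close> odd) or \<open>r = 2 n - 1\<close> (\<open>n\<close> even) polynomials. They turn out to be a regular sequence,
  and the dimension is \<open>N - r\<close>.

  The indeterminates can be given weights such that the heaviest part of each of these polynomials is
  a single product of two indeterminates, up to sign, and such that no indeterminate occurs in two of
  these \<open>r\<close> products (\<open>commutator_leading_terms\<close>). Polynomials with pairwise coprime leading monomials
  behave like the monomials: the heaviest monomials of a nonzero element of the ideal are divisible by
  one of the leading monomials (\<open>top_monomial_nonstandard\<close>), and this also holds for the ideals generated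
  by some of the polynomials. It follows that the sequence is regular (\<open>regular_sequence_map\<close>).

  For the upper bound on the dimension, the quotient is spanned by the monomials that are divisible by
  no leading monomial, and only \<open>O(t^(N - r))\<close> of them have degree at most \<open>t\<close>. On the other hand, a chain
  of \<open>d + 1\<close> primes yields \<open>d\<close> elements that are algebraically independent modulo the smallest prime
  (\<open>prime_chain_power_products_independent\<close>), hence about \<open>t^d\<close> linearly independent elements of degree
  \<open>O(t)\<close>. Comparing the growth gives \<open>d \<le> N - r\<close> (\<open>krull_dim_quotient_le\<close>).

  For the lower bound, the generators are linear in \<open>Y\<close>, and the \<open>r\<close> linear equations have rank \<open>r\<close> when
  \<open>X\<close> is the matrix of a cyclic permutation (\<open>det_pivots_nonzero\<close>). Cramer's rule therefore solves them for
  \<open>r\<close> of the entries of \<open>Y\<close> and parametrizes a part of the zero set by \<open>N - r\<close> free parameters. Fixing the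
  parameters one after the other gives a chain of \<open>N - r + 1\<close> primes
  (\<open>krull_dim_quotient_ge_parametrization\<close>).\<close>

section \<open>Ideals of polynomial rings\<close>

abbreviation const :: "'k::comm_ring_1 \<Rightarrow> ('v, 'k) mpoly" where
  "const c \<equiv> Poly_Mapping.single 0 c"

lemma poly_ring_simps [simp]:
  "monoid.mult (poly_ring V) = (*)" "one (poly_ring V) = 1" "zero (poly_ring V) = 0" "add (poly_ring V) = (+)"
  by (simp_all add: poly_ring_def)

lemma poly_ring_carrier:
  "p \<in> carrier (poly_ring V) \<longleftrightarrow> (\<forall>m\<in>Poly_Mapping.keys p. Poly_Mapping.keys m \<subseteq> V)"
  by (simp add: poly_ring_def)

lemma poly_ring_ring: "ring (poly_ring V :: ('v, 'k::comm_ring_1) mpoly ring)"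
  using poly_ring_cring cring.axioms(1) by blast

context
  fixes V :: "'v set"
begin

private abbreviation (input) "Q \<equiv> (poly_ring V :: ('v, 'k::comm_ring_1) mpoly ring)"

lemma carrier_zero [simp]: "0 \<in> carrier Q" and carrier_one [simp]: "1 \<in> carrier Q"
  by (simp_all add: poly_ring_carrier)

lemma carrier_add: "p \<in> carrier Q \<Longrightarrow> q \<in> carrier Q \<Longrightarrow> p + q \<in> carrier Q"
  using cring.cring_simprules(1)[OF poly_ring_cring, of p V q] by simp

lemma carrier_mult: "p \<in> carrier Q \<Longrightarrow> q \<in> carrier Q \<Longrightarrow> p * q \<in> carrier Q"
  using cring.cring_simprules(5)[OF poly_ring_cring, of p V q] by simp

lemma carrier_uminus: "p \<in> carrier Q \<Longrightarrow> - p \<in> carrier Q"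
  by (simp add: poly_ring_carrier)

lemma carrier_diff: "p \<in> carrier Q \<Longrightarrow> q \<in> carrier Q \<Longrightarrow> p - q \<in> carrier Q"
  using carrier_add[of p "- q"] carrier_uminus[of q] by simp

lemma carrier_sum: "(\<And>a. a \<in> A \<Longrightarrow> p a \<in> carrier Q) \<Longrightarrow> sum p A \<in> carrier Q"
  by (induction A rule: infinite_finite_induct) (simp_all add: carrier_add)

lemma carrier_prod: "(\<And>a. a \<in> A \<Longrightarrow> p a \<in> carrier Q) \<Longrightarrow> prod p A \<in> carrier Q"
  by (induction A rule: infinite_finite_induct) (simp_all add: carrier_mult)

lemma carrier_power: "p \<in> carrier Q \<Longrightarrow> p ^ k \<in> carrier Q"
  by (induction k) (simp_all add: carrier_mult)

lemma carrier_single: "Poly_Mapping.keys m \<subseteq> V \<Longrightarrow> Poly_Mapping.single m c \<in> carrier Q"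
  by (simp add: poly_ring_carrier)

lemma carrier_const [simp]: "const c \<in> carrier Q"
  by (simp add: carrier_single)

lemma carrier_indet: "v \<in> V \<Longrightarrow> indet v \<in> carrier Q"
  by (simp add: indet_def carrier_single)

lemmas carrier_intros =
  carrier_add carrier_mult carrier_uminus carrier_diff carrier_sum carrier_prod carrier_power
  carrier_single carrier_indet

lemma poly_ring_a_inv: "p \<in> carrier Q \<Longrightarrow> \<ominus>\<^bsub>Q\<^esub> p = - p"
  by (rule abelian_group.minus_equality[OF ring.is_abelian_group[OF poly_ring_ring]])
    (simp_all add: carrier_uminus)

lemma ideal_poly_ringI:
  assumes "J \<subseteq> carrier Q" "0 \<in> J" "\<And>p q. p \<in> J \<Longrightarrow> q \<in> J \<Longrightarrow> p + q \<in> J"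
    and "\<And>p q. p \<in> J \<Longrightarrow> q \<in> carrier Q \<Longrightarrow> q * p \<in> J"
  shows "ideal J Q"
proof (rule idealI[OF poly_ring_ring])
  have "- p \<in> J" if "p \<in> J" for p
    using assms(4)[OF that, of "- 1"] by (simp add: carrier_uminus)
  then have inv: "inv\<^bsub>add_monoid Q\<^esub> p \<in> J" if "p \<in> J" for p
    using that poly_ring_a_inv[of p] assms(1) by (auto simp: a_inv_def)
  have "group (add_monoid Q)"
    by (rule abelian_group.a_group[OF ring.is_abelian_group[OF poly_ring_ring]])
  then show "subgroup J (add_monoid Q)"
    by (rule group.subgroupI) (use assms(1-3) inv in auto)
qed (use assms(4) in \<open>auto simp: mult.commute\<close>)

context
  fixes J :: "('v, 'k::comm_ring_1) mpoly set"
  assumes J: "ideal J (poly_ring V)"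
begin

lemma ideal_carrier: "p \<in> J \<Longrightarrow> p \<in> carrier Q"
  by (rule ideal.Icarr[OF J])

lemma ideal_zero [simp]: "0 \<in> J"
  using additive_subgroup.zero_closed[OF ideal.axioms(1)[OF J]] by simp

lemma ideal_add: "p \<in> J \<Longrightarrow> q \<in> J \<Longrightarrow> p + q \<in> J"
  using additive_subgroup.a_closed[OF ideal.axioms(1)[OF J], of p q] by simp

lemma ideal_mult: "p \<in> J \<Longrightarrow> q \<in> carrier Q \<Longrightarrow> q * p \<in> J"
  using ideal.I_l_closed[OF J, of p q] by simp

lemma ideal_uminus: "p \<in> J \<Longrightarrow> - p \<in> J"
  using ideal_mult[of p "- 1"] by (simp add: carrier_uminus)

lemma ideal_diff: "p \<in> J \<Longrightarrow> q \<in> J \<Longrightarrow> p - q \<in> J"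
  using ideal_add[of p "- q"] ideal_uminus[of q] by simp

lemma ideal_sum: "(\<And>a. a \<in> A \<Longrightarrow> p a \<in> J) \<Longrightarrow> sum p A \<in> J"
  by (induction A rule: infinite_finite_induct) (simp_all add: ideal_add)

lemma ideal_coset_eq_iff:
  assumes "p \<in> carrier Q" "q \<in> carrier Q"
  shows "J +>\<^bsub>Q\<^esub> p = J +>\<^bsub>Q\<^esub> q \<longleftrightarrow> p - q \<in> J"
proof -
  interpret J: ideal J Q by (rule J)
  have "J +>\<^bsub>Q\<^esub> p = J +>\<^bsub>Q\<^esub> q \<longleftrightarrow> p \<in> J +>\<^bsub>Q\<^esub> q"
    using assms J.a_repr_independence'[of p q] J.a_rcos_self[of p] by auto
  also have "\<dots> \<longleftrightarrow> p - q \<in> J"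
  proof
    assume "p \<in> J +>\<^bsub>Q\<^esub> q"
    then obtain h where "h \<in> J" "p = h + q"
      unfolding a_r_coset_def' by auto
    then show "p - q \<in> J"
      by simp
  next
    assume "p - q \<in> J"
    then have "(p - q) + q \<in> J +>\<^bsub>Q\<^esub> q"
      unfolding a_r_coset_def' by (intro CollectI UN_I[of "p - q"]) simp_all
    then show "p \<in> J +>\<^bsub>Q\<^esub> q"
      by simp
  qed
  finally show ?thesis .
qed

lemma ideal_coset_eq_self_iff:
  assumes "p \<in> carrier Q"
  shows "J +>\<^bsub>Q\<^esub> p = J \<longleftrightarrow> p \<in> J"
proof -
  have "J \<subseteq> carrier Q"
    by (rule subsetI) (rule ideal_carrier)
  then have "J +>\<^bsub>Q\<^esub> 0 = J"
    using abelian_group.a_coset_add_zero[OF ring.is_abelian_group[OF poly_ring_ring], of J V] by simp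
  then show ?thesis
    using ideal_coset_eq_iff[OF assms carrier_zero] by simp
qed

end
end

section \<open>Weights and degrees of monomials\<close>

lemma lookup_single_times:
  fixes m :: "'a::cancel_comm_monoid_add"
  shows "Poly_Mapping.lookup (Poly_Mapping.single m u * p) (m + k) = u * Poly_Mapping.lookup p k"
  by (simp add: lookup_mult lookup_single when_mult)

definition weight :: "('v \<Rightarrow> nat) \<Rightarrow> ('v \<Rightarrow>\<^sub>0 nat) \<Rightarrow> nat" where
  "weight w m = (\<Sum>v\<in>Poly_Mapping.keys m. w v * Poly_Mapping.lookup m v)"

lemma weight_superset:
  assumes "finite A" "Poly_Mapping.keys m \<subseteq> A"
  shows "weight w m = (\<Sum>v\<in>A. w v * Poly_Mapping.lookup m v)"
  unfolding weight_def
  by (rule sum.mono_neutral_left) (use assms in \<open>auto simp: in_keys_iff\<close>)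

lemma weight_add [simp]: "weight w (m + m') = weight w m + weight w m'"
proof -
  let ?A = "Poly_Mapping.keys m \<union> Poly_Mapping.keys m'"
  have "Poly_Mapping.keys (m + m') \<subseteq> ?A"
    by (rule Poly_Mapping.keys_add)
  then show ?thesis
    by (simp add: weight_superset[of ?A] lookup_add distrib_left sum.distrib)
qed

lemma weight_zero [simp]: "weight w 0 = 0"
  by (simp add: weight_def)

lemma weight_single [simp]: "weight w (Poly_Mapping.single v k) = w v * k"
  by (simp add: weight_def)

abbreviation tdeg :: "('v \<Rightarrow>\<^sub>0 nat) \<Rightarrow> nat" where
  "tdeg \<equiv> weight (\<lambda>_. 1)"

lemma lookup_le_tdeg: "Poly_Mapping.lookup m v \<le> tdeg m"
proof (cases "v \<in> Poly_Mapping.keys m")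
  case True
  then show ?thesis
    unfolding weight_def by (simp add: member_le_sum)
qed (simp add: in_keys_iff)

definition deg_le :: "nat \<Rightarrow> ('v, 'k::comm_ring_1) mpoly \<Rightarrow> bool" where
  "deg_le t p \<longleftrightarrow> (\<forall>m\<in>Poly_Mapping.keys p. tdeg m \<le> t)"

lemma deg_le_one [simp]: "deg_le t 1"
  by (simp add: deg_le_def)

lemma deg_le_mono: "deg_le s p \<Longrightarrow> s \<le> t \<Longrightarrow> deg_le t p"
  by (auto simp: deg_le_def)

lemma deg_le_mult:
  assumes "deg_le s p" "deg_le t q"
  shows "deg_le (s + t) (p * q)"
  unfolding deg_le_def
proof
  fix m assume "m \<in> Poly_Mapping.keys (p * q)"
  then obtain a b where "m = a + b" "a \<in> Poly_Mapping.keys p" "b \<in> Poly_Mapping.keys q"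
    using keys_mult[of p q] by blast
  then show "tdeg m \<le> s + t"
    using assms by (auto simp: deg_le_def intro: add_mono)
qed

lemma deg_le_power: "deg_le s p \<Longrightarrow> deg_le (k * s) (p ^ k)"
  by (induction k) (simp_all add: deg_le_mult)

lemma deg_le_prod:
  assumes "\<And>i. i < (d::nat) \<Longrightarrow> deg_le s (p i)"
  shows "deg_le (d * s) (\<Prod>i<d. p i)"
  using assms
proof (induction d)
  case (Suc d)
  then have "deg_le (d * s + s) ((\<Prod>i<d. p i) * p d)"
    by (intro deg_le_mult) auto
  then show ?case
    by (simp add: add.commute)
qed simp

lemma mpoly_eq_sum_single:
  "p = (\<Sum>k\<in>Poly_Mapping.keys p. Poly_Mapping.single k (Poly_Mapping.lookup p k))"
  by (rule poly_mapping_eqI)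
    (auto simp: lookup_sum lookup_single when_def in_keys_iff)

lemma exists_deg_le: "\<exists>t. deg_le t p"
proof -
  have "finite (tdeg ` Poly_Mapping.keys p)"
    by simp
  then obtain t where "\<forall>n\<in>tdeg ` Poly_Mapping.keys p. n \<le> t"
    unfolding finite_nat_set_iff_bounded_le by blast
  then show ?thesis
    by (auto simp: deg_le_def)
qed

lemma card_bounded_monomials:
  assumes "finite W"
  shows "finite {m :: 'v \<Rightarrow>\<^sub>0 nat. Poly_Mapping.keys m \<subseteq> W \<and> (\<forall>v. Poly_Mapping.lookup m v \<le> t)}" (is "finite ?M")
    and "card {m :: 'v \<Rightarrow>\<^sub>0 nat. Poly_Mapping.keys m \<subseteq> W \<and> (\<forall>v. Poly_Mapping.lookup m v \<le> t)} \<le> (t + 1) ^ card W"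
proof -
  let ?h = "\<lambda>m. restrict (Poly_Mapping.lookup m) W"
  have inj: "inj_on ?h ?M"
  proof (rule inj_onI, rule poly_mapping_eqI)
    fix m m' v assume m: "m \<in> ?M" "m' \<in> ?M" and eq: "?h m = ?h m'"
    show "Poly_Mapping.lookup m v = Poly_Mapping.lookup m' v"
    proof (cases "v \<in> W")
      case True
      then show ?thesis
        using fun_cong[OF eq, of v] by simp
    next
      case False
      then have "v \<notin> Poly_Mapping.keys m" "v \<notin> Poly_Mapping.keys m'"
        using m by auto
      then show ?thesis
        by (simp add: in_keys_iff)
    qed
  qed
  have sub: "?h ` ?M \<subseteq> W \<rightarrow>\<^sub>E {..t}"
    by auto
  have fin: "finite (W \<rightarrow>\<^sub>E {..t})"
    using assms by (intro finite_PiE) auto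
  show "finite ?M"
    by (rule inj_on_finite[OF inj sub fin])
  have "card ?M \<le> card (W \<rightarrow>\<^sub>E {..t})"
    by (rule card_inj_on_le[OF inj sub fin])
  then show "card ?M \<le> (t + 1) ^ card W"
    using assms by (simp add: card_PiE)
qed

section \<open>Chains of primes above an ideal\<close>

lemma krull_dim_leI:
  assumes "\<And>Ps. Ps \<noteq> [] \<Longrightarrow> (\<forall>P\<in>set Ps. primeideal P R) \<Longrightarrow> sorted_wrt (\<subset>) Ps \<Longrightarrow> length Ps \<le> Suc q"
  shows "krull_dim R \<le> enat q"
  unfolding krull_dim_def
proof (rule SUP_least)
  fix Ps assume "Ps \<in> {Ps. Ps \<noteq> [] \<and> (\<forall>P\<in>set Ps. primeideal P R) \<and> sorted_wrt (\<subset>) Ps}"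
  then show "enat (length Ps - 1) \<le> enat q"
    using assms[of Ps] by auto
qed

lemma krull_dim_geI:
  assumes "\<And>i. i \<le> q \<Longrightarrow> primeideal (P i) R" "\<And>i. i < q \<Longrightarrow> P i \<subset> P (Suc i)"
  shows "enat q \<le> krull_dim R"
  unfolding krull_dim_def
proof (rule SUP_upper2)
  let ?Ps = "map P [0..<Suc q]"
  have "sorted_wrt (\<subset>) ?Ps"
    using assms(2) by (subst sorted_wrt_iff_nth_Suc_transp)
      (auto intro!: transpI simp del: upt_Suc)
  then show "?Ps \<in> {Ps. Ps \<noteq> [] \<and> (\<forall>P\<in>set Ps. primeideal P R) \<and> sorted_wrt (\<subset>) Ps}"
    using assms(1) by auto
qed simp

lemma (in cring) primeideal_vimage_quotient:
  assumes I: "ideal I R" and P: "primeideal P (R Quot I)"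
  shows "primeideal {r \<in> carrier R. I +> r \<in> P} R"
proof -
  interpret I: ideal I R by (rule I)
  interpret h: ring_hom_cring R "R Quot I" "(+>) I"
    by (rule I.rcos_ring_hom_cring) (rule is_cring)
  interpret P: primeideal P "R Quot I" by (rule P)
  show ?thesis
  proof (rule primeidealI)
    show "ideal {r \<in> carrier R. I +> r \<in> P} R"
      by (rule ring_hom_ring.ideal_vimage[OF I.rcos_ring_hom_ring P.is_ideal])
    show "carrier R \<noteq> {r \<in> carrier R. I +> r \<in> P}"
    proof
      assume "carrier R = {r \<in> carrier R. I +> r \<in> P}"
      then have "I +> \<one> \<in> P"
        using one_closed by blast
      then show False
        using P.one_imp_carrier P.I_notcarr by simp
    qed
  qed (use P.I_prime is_cring in auto)
qed

text \<open>As \<open>P\<close> contains \<open>I\<close>, a coset of \<open>I\<close> lies in the image of \<open>P\<close> as soon as one of its representatives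
  lies in \<open>P\<close>, and then they all do; primality is thus inherited.\<close>

lemma primeideal_image_quotient:
  fixes I :: "('v, 'k::comm_ring_1) mpoly set"
  assumes I: "ideal I (poly_ring V)" and P: "primeideal P (poly_ring V)" and "I \<subseteq> P"
  shows "primeideal (((+>\<^bsub>poly_ring V\<^esub>) I) ` P) (poly_ring V Quot I)"
proof -
  let ?R = "poly_ring V :: ('v, 'k) mpoly ring"
  interpret R: cring ?R by (rule poly_ring_cring)
  interpret I: ideal I ?R by (rule I)
  interpret h: ring_hom_cring ?R "?R Quot I" "(+>\<^bsub>?R\<^esub>) I"
    by (rule I.rcos_ring_hom_cring) (rule R.is_cring)
  interpret P: primeideal P ?R by (rule P)
  have mem: "I +>\<^bsub>?R\<^esub> x \<in> ((+>\<^bsub>?R\<^esub>) I) ` P \<longleftrightarrow> x \<in> P" if x: "x \<in> carrier ?R" for x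
  proof
    assume "I +>\<^bsub>?R\<^esub> x \<in> ((+>\<^bsub>?R\<^esub>) I) ` P"
    then obtain p where p: "p \<in> P" "I +>\<^bsub>?R\<^esub> x = I +>\<^bsub>?R\<^esub> p"
      by auto
    then have "x - p \<in> P"
      using x ideal_coset_eq_iff[OF I x] P.Icarr \<open>I \<subseteq> P\<close> by blast
    then have "(x - p) + p \<in> P"
      using p(1) by (rule ideal_add[OF P.is_ideal])
    then show "x \<in> P"
      by simp
  qed simp
  have coset: "\<exists>x\<in>carrier ?R. X = I +>\<^bsub>?R\<^esub> x" if "X \<in> carrier (?R Quot I)" for X
    using that by (auto simp: FactRing_def A_RCOSETS_def')
  show ?thesis
  proof (rule primeidealI)
    show "ideal (((+>\<^bsub>?R\<^esub>) I) ` P) (?R Quot I)"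
      by (rule R.ring_ideal_imp_quot_ideal[OF I P.is_ideal])
    show "cring (?R Quot I)"
      by (rule h.S.is_cring)
    show "carrier (?R Quot I) \<noteq> ((+>\<^bsub>?R\<^esub>) I) ` P"
    proof
      assume eq: "carrier (?R Quot I) = ((+>\<^bsub>?R\<^esub>) I) ` P"
      have "I +>\<^bsub>?R\<^esub> \<one>\<^bsub>?R\<^esub> \<in> carrier (?R Quot I)"
        by (rule h.hom_closed) (rule R.one_closed)
      then have "\<one>\<^bsub>?R\<^esub> \<in> P"
        unfolding eq using mem[OF R.one_closed] by blast
      then show False
        using P.one_imp_carrier P.I_notcarr by blast
    qed
  next
    fix A B assume A: "A \<in> carrier (?R Quot I)" and B: "B \<in> carrier (?R Quot I)"
      and AB: "A \<otimes>\<^bsub>?R Quot I\<^esub> B \<in> ((+>\<^bsub>?R\<^esub>) I) ` P"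
    obtain a b where a: "a \<in> carrier ?R" "A = I +>\<^bsub>?R\<^esub> a" and b: "b \<in> carrier ?R" "B = I +>\<^bsub>?R\<^esub> b"
      using coset[OF A] coset[OF B] by blast
    have "I +>\<^bsub>?R\<^esub> (a \<otimes>\<^bsub>?R\<^esub> b) \<in> ((+>\<^bsub>?R\<^esub>) I) ` P"
      using AB h.hom_mult[OF a(1) b(1)] unfolding a(2) b(2) by simp
    then have "a \<otimes>\<^bsub>?R\<^esub> b \<in> P"
      using mem[OF R.m_closed[OF a(1) b(1)]] by blast
    then show "A \<in> ((+>\<^bsub>?R\<^esub>) I) ` P \<or> B \<in> ((+>\<^bsub>?R\<^esub>) I) ` P"
      using P.I_prime[OF a(1) b(1)] a(2) b(2) by blast
  qed
qed

lemma krull_dim_quotient_ge: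
  fixes I :: "('v, 'k::comm_ring_1) mpoly set"
  assumes I: "ideal I (poly_ring V)"
    and prime: "\<And>i. i \<le> q \<Longrightarrow> primeideal (P i) (poly_ring V)"
    and strict: "\<And>i. i < q \<Longrightarrow> P i \<subset> P (Suc i)" and "\<And>i. i \<le> q \<Longrightarrow> I \<subseteq> P i"
  shows "enat q \<le> krull_dim (poly_ring V Quot I)"
proof (rule krull_dim_geI)
  let ?R = "poly_ring V :: ('v, 'k) mpoly ring"
  let ?P = "\<lambda>i. ((+>\<^bsub>?R\<^esub>) I) ` P i"
  show "primeideal (?P i) (?R Quot I)" if "i \<le> q" for i
    by (rule primeideal_image_quotient) (use that assms in auto)
  show "?P i \<subset> ?P (Suc i)" if i: "i < q" for i
  proof -
    have id: "ideal (P i) ?R" "ideal (P (Suc i)) ?R"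
      using i prime[of i] prime[of "Suc i"] by (simp_all add: primeideal.axioms(1))
    obtain x where x: "x \<in> P (Suc i)" "x \<notin> P i"
      using strict[OF i] by blast
    have "I +>\<^bsub>?R\<^esub> x \<noteq> I +>\<^bsub>?R\<^esub> y" if "y \<in> P i" for y
    proof
      assume "I +>\<^bsub>?R\<^esub> x = I +>\<^bsub>?R\<^esub> y"
      then have "x - y \<in> I"
        using ideal_coset_eq_iff[OF I, of x y] x that id by (simp add: ideal_carrier[of _ V])
      then have "(x - y) + y \<in> P i"
        using that \<open>i < q\<close> assms(4)[of i] by (intro ideal_add[OF id(1)]) auto
      then show False
        using x by simp
    qed
    then have "I +>\<^bsub>?R\<^esub> x \<notin> ?P i"
      by blast
    then show ?thesis
      using x strict[OF i] by blast
  qed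
qed

section \<open>Bounding the Krull dimension by counting\<close>

text \<open>Gaussian elimination: one of the equations is solved for one of its unknowns, which leaves one
  equation and one unknown less.\<close>

lemma exists_linear_relation:
  fixes M :: "'a \<Rightarrow> 'b \<Rightarrow> 'k::field"
  assumes "finite B" "finite A" "card B < card A"
  shows "\<exists>c. (\<exists>a\<in>A. c a \<noteq> 0) \<and> (\<forall>b\<in>B. (\<Sum>a\<in>A. c a * M a b) = 0)"
  using assms
proof (induction B arbitrary: A M rule: finite_induct)
  case empty
  then obtain a where "a \<in> A"
    by (metis card.empty card_gt_0_iff ex_in_conv)
  then show ?case
    by (intro exI[of _ "\<lambda>_. 1"]) auto
next
  case (insert b B)
  show ?case
  proof (cases "\<forall>a\<in>A. M a b = 0")
    case True
    have "card B < card A"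
      using insert by simp
    then show ?thesis
      using insert.IH[OF \<open>finite A\<close>, of M] True by auto
  next
    case False
    then obtain a0 where a0: "a0 \<in> A" "M a0 b \<noteq> 0"
      by blast
    let ?A = "A - {a0}"
    let ?M = "\<lambda>a b'. M a b' - M a b / M a0 b * M a0 b'"
    have "card B < card ?A"
      using insert a0 by (simp add: card_Diff_singleton)
    then obtain c where c: "\<exists>a\<in>?A. c a \<noteq> 0" "\<forall>b'\<in>B. (\<Sum>a\<in>?A. c a * ?M a b') = 0"
      using insert.IH[of ?A ?M] \<open>finite A\<close> by auto
    define c' where "c' = c(a0 := - (\<Sum>a\<in>?A. c a * M a b) / M a0 b)"
    have sum: "(\<Sum>a\<in>A. c' a * M a b') = (\<Sum>a\<in>?A. c a * ?M a b')" for b'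
    proof -
      have "(\<Sum>a\<in>A. c' a * M a b') = c' a0 * M a0 b' + (\<Sum>a\<in>?A. c' a * M a b')"
        using \<open>finite A\<close> a0 by (simp add: sum.remove)
      also have "(\<Sum>a\<in>?A. c' a * M a b') = (\<Sum>a\<in>?A. c a * M a b')"
        by (rule sum.cong) (auto simp: c'_def)
      also have "c' a0 * M a0 b' = - (\<Sum>a\<in>?A. c a * (M a b / M a0 b * M a0 b'))"
        by (simp add: c'_def sum_distrib_right sum_divide_distrib mult.assoc)
      finally show ?thesis
        by (simp add: right_diff_distrib sum_subtractf)
    qed
    have "(\<Sum>a\<in>A. c' a * M a b') = 0" if "b' \<in> insert b B" for b'
      using that c(2) a0(2) unfolding sum by auto
    moreover have "\<exists>a\<in>A. c' a \<noteq> 0"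
      using c(1) by (auto simp: c'_def)
    ultimately show ?thesis
      by blast
  qed
qed

definition power_product :: "(nat \<Rightarrow> 'a::comm_monoid_mult) \<Rightarrow> nat list \<Rightarrow> 'a" where
  "power_product f es = (\<Prod>i<length es. f i ^ (es ! i))"

lemma power_product_Nil [simp]: "power_product f [] = 1"
  by (simp add: power_product_def)

lemma power_product_Cons [simp]:
  "power_product f (e # es) = f 0 ^ e * power_product (\<lambda>i. f (Suc i)) es"
  by (simp add: power_product_def prod.lessThan_Suc_shift del: prod.lessThan_Suc)

lemma carrier_power_product:
  "(\<And>i. i < length es \<Longrightarrow> f i \<in> carrier (poly_ring V)) \<Longrightarrow> power_product f es \<in> carrier (poly_ring V)"
  unfolding power_product_def by (intro carrier_intros) auto

lemma primeideal_const:
  fixes P :: "('v, 'k::field) mpoly set"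
  assumes P: "primeideal P (poly_ring V)" and c: "const c \<in> P"
  shows "c = 0"
proof (rule ccontr)
  assume "c \<noteq> 0"
  interpret P: primeideal P "poly_ring V" by (rule P)
  have "const (inverse c) * const c \<in> P"
    by (rule ideal_mult[OF P.is_ideal c]) simp
  then have "1 \<in> P"
    using \<open>c \<noteq> 0\<close> by (simp add: mult_single)
  then show False
    using P.one_imp_carrier P.I_notcarr by simp
qed

text \<open>The elements \<open>f 0, \<dots>, f (d - 1)\<close> picked along a chain of primes are algebraically independent
  modulo the smallest of them. Sort a relation by powers of \<open>f 0\<close>, say \<open>\<Sum>e. f 0 ^ e * G e \<in> P 0\<close> where
  the \<open>G e\<close> involve the later \<open>f i\<close> only. Since \<open>f 0 \<in> P 1\<close>, the constant term \<open>G 0\<close> lies in \<open>P 1\<close> and has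
  zero coefficients by induction on the length of the chain. What is left is divisible by \<open>f 0\<close>, and
  \<open>f 0\<close> can be cancelled because it is not in the prime \<open>P 0\<close>.\<close>

lemma prime_chain_power_products_independent:
  fixes P :: "nat \<Rightarrow> ('v, 'k::field) mpoly set"
  assumes "\<And>i. i \<le> d \<Longrightarrow> primeideal (P i) (poly_ring V)"
    and "\<And>i. i < d \<Longrightarrow> P i \<subseteq> P (Suc i)"
    and "\<And>i. i < d \<Longrightarrow> f i \<in> P (Suc i) - P i"
    and "(\<Sum>es | set es \<subseteq> {..<T} \<and> length es = d. const (c es) * power_product f es) \<in> P 0"
    and "set es \<subseteq> {..<T}" "length es = d"
  shows "c es = 0"
  using assms
proof (induction d arbitrary: P f c es)
  case 0
  have "{es. set es \<subseteq> {..<T} \<and> length es = 0} = {[]}"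
    by auto
  then have "const (c []) \<in> P 0"
    using 0(4) by simp
  then show ?case
    using primeideal_const[of "P 0"] 0 by simp
next
  case (Suc d)
  let ?R = "poly_ring V :: ('v, 'k) mpoly ring"
  let ?B = "{es. set es \<subseteq> {..<T} \<and> length es = d}"
  let ?f = "\<lambda>i. f (Suc i)"
  have id: "ideal (P i) ?R" if "i \<le> Suc d" for i
    using Suc.prems(1)[OF that] by (rule primeideal.axioms(1))
  have f: "f i \<in> carrier ?R" if "i < Suc d" for i
    using Suc.prems(3)[OF that] ideal_carrier[OF id[of "Suc i"]] that by auto
  define G where "G e = (\<Sum>es\<in>?B. const (c (e # es)) * power_product ?f es)" for e
  have G: "G e \<in> carrier ?R" for e
    unfolding G_def by (intro carrier_intros carrier_power_product) (use f in auto)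
  have IH: "c (e # es) = 0" if "G e \<in> P 1" "es \<in> ?B" for e es
  proof (rule Suc.IH[where P = "\<lambda>i. P (Suc i)" and f = ?f and c = "\<lambda>es. c (e # es)"])
    show "(\<Sum>es\<in>?B. const (c (e # es)) * power_product ?f es) \<in> P (Suc 0)"
      using that(1) by (simp add: G_def)
  qed (use Suc.prems(1-3) that(2) in auto)
  have peel: "\<forall>e<s. \<forall>es\<in>?B. c ((e0 + e) # es) = 0"
    if "(\<Sum>e<s. f 0 ^ e * G (e0 + e)) \<in> P 0" for s e0
    using that
  proof (induction s arbitrary: e0)
    case (Suc s)
    let ?S = "\<Sum>e<s. f 0 ^ e * G (Suc e0 + e)"
    have S: "?S \<in> carrier ?R"
      by (intro carrier_intros G f) simp
    have split: "(\<Sum>e<Suc s. f 0 ^ e * G (e0 + e)) = G e0 + ?S * f 0"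
      by (simp add: sum.lessThan_Suc_shift sum_distrib_left sum_distrib_right ac_simps del: sum.lessThan_Suc)
    have "(G e0 + ?S * f 0) - ?S * f 0 \<in> P 1"
    proof (rule ideal_diff[OF id])
      show "G e0 + ?S * f 0 \<in> P 1"
        using Suc.prems \<open>\<And>i. i < Suc d \<Longrightarrow> P i \<subseteq> P (Suc i)\<close>[of 0] unfolding split by auto
      show "?S * f 0 \<in> P 1"
        by (rule ideal_mult[OF id _ S])
          (use \<open>\<And>i. i < Suc d \<Longrightarrow> f i \<in> P (Suc i) - P i\<close>[of 0] in auto)
    qed simp
    then have c0: "\<forall>es\<in>?B. c (e0 # es) = 0"
      using IH by simp
    then have "G e0 = 0"
      by (simp add: G_def)
    then have "f 0 * ?S \<in> P 0"
      using Suc.prems unfolding split by (simp add: mult.commute)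
    then have "?S \<in> P 0"
      using primeideal.I_prime[OF \<open>\<And>i. i \<le> Suc d \<Longrightarrow> primeideal (P i) ?R\<close>[of 0] f[of 0] S]
        \<open>\<And>i. i < Suc d \<Longrightarrow> f i \<in> P (Suc i) - P i\<close>[of 0] by auto
    then have "\<forall>e<s. \<forall>es\<in>?B. c ((Suc e0 + e) # es) = 0"
      by (rule Suc.IH)
    with c0 show ?case
      by (auto simp: less_Suc_eq_0_disj)
  qed simp
  have lists: "{es. set es \<subseteq> {..<T} \<and> length es = Suc d} = (\<lambda>(e, es). e # es) ` ({..<T} \<times> ?B)"
    by (auto simp: length_Suc_conv image_iff)
  have "(\<Sum>es | set es \<subseteq> {..<T} \<and> length es = Suc d. const (c es) * power_product f es) =
      (\<Sum>(e, es)\<in>{..<T} \<times> ?B. const (c (e # es)) * power_product f (e # es))"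
    unfolding lists by (subst sum.reindex) (auto simp: inj_on_def case_prod_unfold)
  also have "\<dots> = (\<Sum>e<T. f 0 ^ e * G (0 + e))"
    by (simp add: G_def sum.cartesian_product[symmetric] sum_distrib_left ac_simps)
  finally have "\<forall>e<T. \<forall>es\<in>?B. c ((0 + e) # es) = 0"
    using Suc.prems(4) by (intro peel) simp
  then show ?case
    using Suc.prems(5,6) by (cases es) auto
qed

text \<open>If the polynomials of degree at most \<open>t\<close> span a space of dimension \<open>O(t^q)\<close> modulo \<open>I\<close>, a chain of
  \<open>d + 1\<close> primes above \<open>I\<close> has \<open>d \<le> q\<close>: the products of powers with exponents below \<open>T\<close> of the \<open>d\<close>
  elements picked along the chain are \<open>T ^ d\<close> independent elements, whose degree is \<open>O(T)\<close>.\<close>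

theorem krull_dim_quotient_le:
  fixes I :: "('v, 'k::field) mpoly set"
  assumes I: "ideal I (poly_ring V)"
    and span: "\<And>t. \<exists>B. finite B \<and> card B \<le> c * (t + 1) ^ q \<and>
      (\<forall>p\<in>carrier (poly_ring V). deg_le t p \<longrightarrow> (\<exists>s. p - s \<in> I \<and> Poly_Mapping.keys s \<subseteq> B))"
  shows "krull_dim (poly_ring V Quot I) \<le> enat q"
proof (rule krull_dim_leI)
  let ?R = "poly_ring V :: ('v, 'k) mpoly ring"
  fix Ps assume Ps: "Ps \<noteq> []" "\<forall>P\<in>set Ps. primeideal P (?R Quot I)" "sorted_wrt (\<subset>) Ps"
  define d where "d = length Ps - 1"
  define P where "P i = {r \<in> carrier ?R. I +>\<^bsub>?R\<^esub> r \<in> Ps ! i}" for i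
  have len: "length Ps = Suc d"
    using Ps(1) by (simp add: d_def)
  interpret R: cring ?R by (rule poly_ring_cring)
  have prime: "primeideal (P i) ?R" if "i \<le> d" for i
    unfolding P_def by (rule R.primeideal_vimage_quotient[OF I]) (use that Ps(2) len in auto)
  have less: "Ps ! i \<subset> Ps ! Suc i" if "i < d" for i
    using sorted_wrt_nth_less[OF Ps(3), of i "Suc i"] that len by simp
  have sub: "P i \<subseteq> P (Suc i)" if "i < d" for i
    using less[OF that] by (auto simp: P_def)
  have "\<exists>f. f \<in> P (Suc i) - P i" if i: "i < d" for i
  proof -
    obtain X where X: "X \<in> Ps ! Suc i" "X \<notin> Ps ! i"
      using less[OF i] by blast
    have "ideal (Ps ! Suc i) (?R Quot I)"
      using Ps(2) len i by (simp add: primeideal.axioms(1))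
    then have "X \<in> carrier (?R Quot I)"
      using X(1) by (rule ideal.Icarr)
    then obtain r where "r \<in> carrier ?R" "X = I +>\<^bsub>?R\<^esub> r"
      by (auto simp: FactRing_def A_RCOSETS_def')
    then show ?thesis
      using X by (auto simp: P_def)
  qed
  then obtain f where f: "\<And>i. i < d \<Longrightarrow> f i \<in> P (Suc i) - P i"
    by metis
  have fc: "f i \<in> carrier ?R" if "i < d" for i
    using f[OF that] by (simp add: P_def)
  have I0: "I \<subseteq> P 0"
  proof
    fix x assume x: "x \<in> I"
    interpret P0: primeideal "Ps ! 0" "?R Quot I"
      using Ps by simp
    have "I \<in> Ps ! 0"
      using additive_subgroup.zero_closed[OF P0.is_additive_subgroup] by (simp add: FactRing_def)
    then show "x \<in> P 0"
      using x ideal_coset_eq_self_iff[OF I ideal_carrier[OF I x]] ideal_carrier[OF I x]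
      by (simp add: P_def)
  qed
  have "finite (tdeg ` (\<Union>i<d. Poly_Mapping.keys (f i)))"
    by simp
  then obtain e where "\<forall>n\<in>tdeg ` (\<Union>i<d. Poly_Mapping.keys (f i)). n \<le> e"
    unfolding finite_nat_set_iff_bounded_le by blast
  then have e: "deg_le e (f i)" if "i < d" for i
    using that by (auto simp: deg_le_def)
  have growth: "T ^ d \<le> c * (d * (T * e) + 1) ^ q" for T
  proof -
    let ?A = "{es. set es \<subseteq> {..<T} \<and> length es = d}"
    obtain B where B: "finite B" "card B \<le> c * (d * (T * e) + 1) ^ q"
      "\<And>p. p \<in> carrier ?R \<Longrightarrow> deg_le (d * (T * e)) p \<Longrightarrow> \<exists>s. p - s \<in> I \<and> Poly_Mapping.keys s \<subseteq> B"
      using span[of "d * (T * e)"] by blast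
    have "\<exists>s. power_product f es - s \<in> I \<and> Poly_Mapping.keys s \<subseteq> B" if es: "es \<in> ?A" for es
    proof (rule B(3))
      show "power_product f es \<in> carrier ?R"
        using es fc by (intro carrier_power_product) auto
      have "deg_le (T * e) (f i ^ (es ! i))" if "i < d" for i
      proof (rule deg_le_mono)
        show "deg_le ((es ! i) * e) (f i ^ (es ! i))"
          by (rule deg_le_power) (rule e[OF that])
        have "es ! i \<in> set es"
          using es that by auto
        then show "es ! i * e \<le> T * e"
          using es by (intro mult_right_mono) auto
      qed
      then show "deg_le (d * (T * e)) (power_product f es)"
        using es deg_le_prod[of d "T * e" "\<lambda>i. f i ^ (es ! i)"] by (simp add: power_product_def)
    qed
    then obtain s where s: "\<And>es. es \<in> ?A \<Longrightarrow> power_product f es - s es \<in> I \<and> Poly_Mapping.keys (s es) \<subseteq> B"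
      by metis
    have finA: "finite ?A"
      by (rule finite_lists_length_eq) simp
    have "card ?A \<le> card B"
    proof (rule ccontr)
      assume "\<not> card ?A \<le> card B"
      then obtain a where a: "\<exists>es\<in>?A. a es \<noteq> 0"
        "\<And>b. b \<in> B \<Longrightarrow> (\<Sum>es\<in>?A. a es * Poly_Mapping.lookup (s es) b) = 0"
        using exists_linear_relation[OF B(1) finA, of "\<lambda>es. Poly_Mapping.lookup (s es)"] by auto
      have lookup_const: "Poly_Mapping.lookup (const r * p) b = r * Poly_Mapping.lookup p b"
        for r :: 'k and p :: "('v, 'k) mpoly" and b
        using lookup_single_times[of 0 r p b] by simp
      have "(\<Sum>es\<in>?A. const (a es) * s es) = 0"
      proof (rule poly_mapping_eqI)
        fix b
        have "(\<Sum>es\<in>?A. a es * Poly_Mapping.lookup (s es) b) = 0"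
        proof (cases "b \<in> B")
          case False
          then have "Poly_Mapping.lookup (s es) b = 0" if "es \<in> ?A" for es
            using s[OF that] by (auto simp: in_keys_iff)
          then show ?thesis
            by simp
        qed (rule a)
        then show "Poly_Mapping.lookup (\<Sum>es\<in>?A. const (a es) * s es) b = Poly_Mapping.lookup 0 b"
          by (simp add: lookup_sum lookup_const)
      qed
      then have "(\<Sum>es\<in>?A. const (a es) * power_product f es) =
          (\<Sum>es\<in>?A. const (a es) * (power_product f es - s es))"
        by (simp add: right_diff_distrib sum_subtractf)
      also have "\<dots> \<in> I"
        using s by (intro ideal_sum[OF I] ideal_mult[OF I]) auto
      finally have "(\<Sum>es\<in>?A. const (a es) * power_product f es) \<in> P 0"
        using I0 by blast
      then have "a es = 0" if "es \<in> ?A" for es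
        using prime_chain_power_products_independent[where P = P and V = V and f = f and d = d and c = a and es = es and T = T, OF prime sub f] that by auto
      then show False
        using a(1) by blast
    qed
    then show ?thesis
      using B(2) by (simp add: card_lists_length_eq)
  qed
  have "d \<le> q"
  proof (rule ccontr)
    assume "\<not> d \<le> q"
    \<comment> \<open>One more than the constant in front of \<open>T ^ q\<close> in the bound below.\<close>
    define T where "T = Suc (c * (d * e + 1) ^ q)"
    have "T * T ^ q \<le> T ^ d"
      using \<open>\<not> d \<le> q\<close> power_increasing[of "Suc q" d T] by (simp add: T_def)
    also have "\<dots> \<le> c * (d * (T * e) + 1) ^ q"
      by (rule growth)
    also have "\<dots> \<le> c * ((d * e + 1) * T) ^ q"
      by (intro mult_left_mono power_mono) (simp_all add: T_def algebra_simps)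
    also have "\<dots> = (c * (d * e + 1) ^ q) * T ^ q"
      by (simp only: power_mult_distrib mult.assoc)
    finally show False
      by (simp add: T_def)
  qed
  then show "length Ps \<le> Suc q"
    by (simp add: len)
qed

section \<open>Polynomials with pairwise coprime leading monomials\<close>

text \<open>A family of polynomials \<open>f e\<close>, each of which has a unique heaviest monomial \<open>a e * b e\<close> for the
  weight \<open>w\<close>, such that no indeterminate occurs in two of these leading monomials. Such a family is a
  Groebner basis of the ideal that it generates, as is each of its subfamilies. The weight takes the
  place of a monomial order: different monomials may have the same weight, and only the leading
  monomials of the \<open>f e\<close> have to be heavier than all others.\<close>

locale coprime_leading_terms =
  fixes V :: "'v set" and E :: "'e set" and f :: "'e \<Rightarrow> ('v, 'k::field) mpoly"
    and a b :: "'e \<Rightarrow> 'v" and w :: "'v \<Rightarrow> nat"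
  assumes finite_V: "finite V" and finite_E: "finite E"
    and a_in: "e \<in> E \<Longrightarrow> a e \<in> V" and b_in: "e \<in> E \<Longrightarrow> b e \<in> V"
    and inj_a: "inj_on a E" and inj_b: "inj_on b E" and disjoint: "a ` E \<inter> b ` E = {}"
    and f_carrier: "e \<in> E \<Longrightarrow> f e \<in> carrier (poly_ring V)"
    and f_deg: "e \<in> E \<Longrightarrow> deg_le 2 (f e)"
    and lead: "e \<in> E \<Longrightarrow> Poly_Mapping.lookup (f e) (Poly_Mapping.single (a e) 1 + Poly_Mapping.single (b e) 1) \<noteq> 0"
    and lower: "e \<in> E \<Longrightarrow> m \<in> Poly_Mapping.keys (f e) \<Longrightarrow>
      m \<noteq> Poly_Mapping.single (a e) 1 + Poly_Mapping.single (b e) 1 \<Longrightarrow> weight w m < w (a e) + w (b e)"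
begin

abbreviation (input) "R \<equiv> poly_ring V :: ('v, 'k) mpoly ring"

abbreviation lead_mon :: "'e \<Rightarrow> 'v \<Rightarrow>\<^sub>0 nat" where
  "lead_mon e \<equiv> Poly_Mapping.single (a e) 1 + Poly_Mapping.single (b e) 1"

definition J :: "'e set \<Rightarrow> ('v, 'k) mpoly set" where
  "J S = Idl\<^bsub>R\<^esub> (f ` S)"

text \<open>The monomials that are divisible by none of the products \<open>a e * b e\<close> with \<open>e \<in> S\<close>.\<close>

definition standard :: "'e set \<Rightarrow> ('v \<Rightarrow>\<^sub>0 nat) \<Rightarrow> bool" where
  "standard S m \<longleftrightarrow> (\<forall>e\<in>S. Poly_Mapping.lookup m (a e) = 0 \<or> Poly_Mapping.lookup m (b e) = 0)"

lemma a_neq_b: "e \<in> E \<Longrightarrow> e' \<in> E \<Longrightarrow> a e \<noteq> b e'"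
  using disjoint by blast

lemma image_carrier: "S \<subseteq> E \<Longrightarrow> f ` S \<subseteq> carrier R"
  using f_carrier by blast

lemma J_ideal: "S \<subseteq> E \<Longrightarrow> ideal (J S) R"
  unfolding J_def by (rule ring.genideal_ideal[OF poly_ring_ring image_carrier])

lemma f_in_J: "S \<subseteq> E \<Longrightarrow> e \<in> S \<Longrightarrow> f e \<in> J S"
  unfolding J_def using ring.genideal_self[OF poly_ring_ring image_carrier, of S] by blast

lemma nonstandard_factor:
  assumes "S \<subseteq> E" "\<not> standard S m"
  obtains e m' where "e \<in> S" "m = lead_mon e + m'" "Poly_Mapping.keys m' \<subseteq> Poly_Mapping.keys m"
proof -
  obtain e where e: "e \<in> S" "Poly_Mapping.lookup m (a e) \<noteq> 0" "Poly_Mapping.lookup m (b e) \<noteq> 0"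
    using assms by (auto simp: standard_def)
  have "a e \<noteq> b e"
    using e(1) assms(1) a_neq_b by blast
  then have "m = lead_mon e + (m - lead_mon e)"
    using e(2,3) by (intro poly_mapping_eqI) (auto simp: lookup_add lookup_minus lookup_single when_def)
  moreover have "Poly_Mapping.keys (m - lead_mon e) \<subseteq> Poly_Mapping.keys m"
    by (auto simp: in_keys_iff lookup_minus)
  ultimately show ?thesis
    using that e(1) by blast
qed

text \<open>This is where it matters that the leading monomials are pairwise coprime.\<close>

lemma standard_lead_mon_add_iff:
  assumes "e \<in> E" "S \<subseteq> E" "e \<notin> S"
  shows "standard S (lead_mon e + m) \<longleftrightarrow> standard S m"
proof -
  have "Poly_Mapping.lookup (lead_mon e + m) (a e') = Poly_Mapping.lookup m (a e')"
    "Poly_Mapping.lookup (lead_mon e + m) (b e') = Poly_Mapping.lookup m (b e')" if "e' \<in> S" for e'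
  proof -
    have "e' \<in> E" "e' \<noteq> e"
      using that assms by auto
    then have "a e' \<noteq> a e" "b e' \<noteq> b e" "a e' \<noteq> b e" "b e' \<noteq> a e"
      using assms(1) inj_a inj_b a_neq_b[of e e'] a_neq_b[of e' e] by (auto dest: inj_onD)
    then show "Poly_Mapping.lookup (lead_mon e + m) (a e') = Poly_Mapping.lookup m (a e')"
      "Poly_Mapping.lookup (lead_mon e + m) (b e') = Poly_Mapping.lookup m (b e')"
      by (auto simp: lookup_add lookup_single when_def)
  qed
  then show ?thesis
    by (simp add: standard_def)
qed

lemma nonstandard_lead_mon_add: "e \<in> S \<Longrightarrow> \<not> standard S (lead_mon e + m)"
  by (auto simp: standard_def lookup_add lookup_single intro!: bexI[of _ e])

text \<open>Having a normal form modulo \<open>J S\<close> of degree at most \<open>t\<close>.\<close>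

definition reducible :: "'e set \<Rightarrow> nat \<Rightarrow> ('v, 'k) mpoly \<Rightarrow> bool" where
  "reducible S t q \<longleftrightarrow>
    (\<exists>p\<in>carrier R. q - p \<in> J S \<and> (\<forall>k\<in>Poly_Mapping.keys p. standard S k) \<and> deg_le t p)"

lemma reducible_add:
  assumes "S \<subseteq> E" "reducible S t q" "reducible S t q'"
  shows "reducible S t (q + q')"
proof -
  obtain p p' where p: "p \<in> carrier R" "q - p \<in> J S" "\<forall>k\<in>Poly_Mapping.keys p. standard S k" "deg_le t p"
    and p': "p' \<in> carrier R" "q' - p' \<in> J S" "\<forall>k\<in>Poly_Mapping.keys p'. standard S k" "deg_le t p'"
    using assms unfolding reducible_def by blast
  have "(q - p) + (q' - p') \<in> J S"
    by (rule ideal_add[OF J_ideal[OF assms(1)] p(2) p'(2)])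
  then have "(q + q') - (p + p') \<in> J S"
    by (simp add: algebra_simps)
  moreover have "p + p' \<in> carrier R"
    by (intro carrier_intros p p')
  moreover have "\<forall>k\<in>Poly_Mapping.keys (p + p'). standard S k \<and> tdeg k \<le> t"
    using Poly_Mapping.keys_add[of p p'] p p' by (auto simp: deg_le_def)
  ultimately show ?thesis
    unfolding reducible_def deg_le_def by blast
qed

lemma reducible_sum:
  assumes "S \<subseteq> E" "\<And>x. x \<in> A \<Longrightarrow> reducible S t (q x)"
  shows "reducible S t (sum q A)"
  using assms(2)
proof (induction A rule: infinite_finite_induct)
  case (insert x F)
  then show ?case
    by (simp add: reducible_add[OF assms(1)])
qed (auto simp: reducible_def deg_le_def ideal_zero[OF J_ideal[OF assms(1)]] intro!: bexI[of _ 0])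

text \<open>Rewriting a multiple of a leading monomial by means of \<open>f e\<close> lowers the weight, so it terminates; it
  does not raise the degree, because the leading monomial of \<open>f e\<close> is also one of highest degree.\<close>

lemma reducible_single:
  assumes "S \<subseteq> E" "Poly_Mapping.keys m \<subseteq> V" "tdeg m \<le> t"
  shows "reducible S t (Poly_Mapping.single m c)"
  using assms(2,3)
proof (induction "weight w m" arbitrary: m c rule: less_induct)
  case less
  show ?case
  proof (cases "standard S m")
    case True
    then show ?thesis
      unfolding reducible_def using less.prems
      by (intro bexI[of _ "Poly_Mapping.single m c"])
        (auto simp: deg_le_def ideal_zero[OF J_ideal[OF assms(1)]] carrier_single)
  next
    case False
    then obtain e m' where e: "e \<in> S" and m: "m = lead_mon e + m'" and m': "Poly_Mapping.keys m' \<subseteq> V"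
      using less.prems assms(1) by (metis nonstandard_factor subset_trans)
    have eE: "e \<in> E"
      using e assms(1) by blast
    define u where "u = Poly_Mapping.lookup (f e) (lead_mon e)"
    define h where "h = Poly_Mapping.single m' (c / u) * (f e - Poly_Mapping.single (lead_mon e) u)"
    have u: "u \<noteq> 0"
      using lead[OF eE] by (simp add: u_def)
    have "Poly_Mapping.keys (lead_mon e) \<subseteq> {a e, b e}"
      by (auto simp: in_keys_iff lookup_add lookup_single when_def split: if_splits)
    then have "Poly_Mapping.keys (lead_mon e) \<subseteq> V"
      using a_in[OF eE] b_in[OF eE] by blast
    then have h_carrier: "h \<in> carrier R"
      unfolding h_def by (intro carrier_intros f_carrier eE m')
    have keys_h: "weight w k < weight w m \<and> tdeg k \<le> t" if "k \<in> Poly_Mapping.keys h" for k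
    proof -
      obtain x k' where x: "x \<in> Poly_Mapping.keys (Poly_Mapping.single m' (c / u))"
        and k': "k = x + k'" "k' \<in> Poly_Mapping.keys (f e - Poly_Mapping.single (lead_mon e) u)"
        using keys_mult \<open>k \<in> Poly_Mapping.keys h\<close> unfolding h_def by blast
      have "x = m'"
        using x by (simp split: if_splits)
      have "k' \<noteq> lead_mon e" "k' \<in> Poly_Mapping.keys (f e)"
        using k'(2) by (auto simp: in_keys_iff lookup_minus lookup_single u_def when_def split: if_splits)
      then have "weight w k' < w (a e) + w (b e)" "tdeg k' \<le> 2"
        using lower[OF eE] f_deg[OF eE] by (auto simp: deg_le_def)
      then show ?thesis
        using less.prems(2) \<open>x = m'\<close> by (simp add: k'(1) m)
    qed
    have "reducible S t (Poly_Mapping.single k (- Poly_Mapping.lookup h k))" if "k \<in> Poly_Mapping.keys h" for k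
      using keys_h[OF that] h_carrier that by (intro less.hyps) (auto simp: poly_ring_carrier)
    then have "reducible S t (\<Sum>k\<in>Poly_Mapping.keys h. Poly_Mapping.single k (- Poly_Mapping.lookup h k))"
      by (rule reducible_sum[OF assms(1)])
    also have "(\<Sum>k\<in>Poly_Mapping.keys h. Poly_Mapping.single k (- Poly_Mapping.lookup h k)) = - h"
      by (subst (4) mpoly_eq_sum_single) (simp add: single_uminus sum_negf)
    finally obtain p where p: "p \<in> carrier R" "- h - p \<in> J S"
      "\<forall>k\<in>Poly_Mapping.keys p. standard S k" "deg_le t p"
      unfolding reducible_def by blast
    have "Poly_Mapping.single m' (c / u) * Poly_Mapping.single (lead_mon e) u = Poly_Mapping.single m c"
      using u by (simp add: mult_single m add.commute)
    then have "Poly_Mapping.single m c - p = Poly_Mapping.single m' (c / u) * f e + (- h - p)"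
      by (simp add: h_def right_diff_distrib)
    also have "\<dots> \<in> J S"
      using m' by (intro ideal_add[OF J_ideal[OF assms(1)]] ideal_mult[OF J_ideal[OF assms(1)]]
          f_in_J assms(1) e p(2) carrier_single)
    finally show ?thesis
      using p unfolding reducible_def by blast
  qed
qed

lemma reducible_deg_le:
  assumes "S \<subseteq> E" "q \<in> carrier R" "deg_le t q"
  shows "reducible S t q"
proof -
  have "reducible S t (\<Sum>k\<in>Poly_Mapping.keys q. Poly_Mapping.single k (Poly_Mapping.lookup q k))"
    using assms(2,3) by (intro reducible_sum reducible_single assms(1)) (auto simp: poly_ring_carrier deg_le_def)
  then show ?thesis
    by (simp flip: mpoly_eq_sum_single)
qed

lemma standard_representative:
  assumes "S \<subseteq> E" "q \<in> carrier R"
  obtains p where "p \<in> carrier R" "q - p \<in> J S" "\<forall>k\<in>Poly_Mapping.keys p. standard S k"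
  using exists_deg_le[of q] reducible_deg_le[OF assms] unfolding reducible_def by blast

definition top_monomial :: "('v, 'k) mpoly \<Rightarrow> ('v \<Rightarrow>\<^sub>0 nat) \<Rightarrow> bool" where
  "top_monomial p k \<longleftrightarrow>
    k \<in> Poly_Mapping.keys p \<and> (\<forall>k'\<in>Poly_Mapping.keys p. weight w k' \<le> weight w k)"

lemma exists_top_monomial:
  assumes "k \<in> Poly_Mapping.keys p"
  obtains k' where "top_monomial p k'"
proof -
  have "finite (weight w ` Poly_Mapping.keys p)" "weight w ` Poly_Mapping.keys p \<noteq> {}"
    using assms by auto
  then obtain k' where "k' \<in> Poly_Mapping.keys p" "weight w k' = Max (weight w ` Poly_Mapping.keys p)"
    using Max_in by (metis (no_types, lifting) imageE)
  then have "top_monomial p k'"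
    by (simp add: top_monomial_def)
  then show ?thesis
    by (rule that)
qed

lemma keys_mult_lead:
  assumes e: "e \<in> E" and top: "top_monomial g k0" and k: "k \<in> Poly_Mapping.keys (f e * g)"
  shows "weight w k < weight w (lead_mon e + k0) \<or>
    (weight w k = weight w (lead_mon e + k0) \<and> (\<exists>k1\<in>Poly_Mapping.keys g. k = lead_mon e + k1))"
proof -
  obtain x y where xy: "k = x + y" "x \<in> Poly_Mapping.keys (f e)" "y \<in> Poly_Mapping.keys g"
    using keys_mult[of "f e" g] k by blast
  have y: "weight w y \<le> weight w k0"
    using top xy(3) by (simp add: top_monomial_def)
  show ?thesis
  proof (cases "x = lead_mon e")
    case True
    then show ?thesis
      using y xy by (auto simp: less_le)
  next
    case False
    then show ?thesis
      using lower[OF e xy(2)] y xy(1) by auto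
  qed
qed

lemma lookup_mult_lead:
  assumes e: "e \<in> E" and top: "top_monomial g k0"
  shows "Poly_Mapping.lookup (f e * g) (lead_mon e + k0) \<noteq> 0"
proof -
  define u where "u = Poly_Mapping.lookup (f e) (lead_mon e)"
  define r where "r = f e - Poly_Mapping.single (lead_mon e) u"
  have "lead_mon e + k0 \<notin> Poly_Mapping.keys (r * g)"
  proof
    assume "lead_mon e + k0 \<in> Poly_Mapping.keys (r * g)"
    then obtain x y where xy: "lead_mon e + k0 = x + y" "x \<in> Poly_Mapping.keys r" "y \<in> Poly_Mapping.keys g"
      using keys_mult[of r g] by blast
    have "x \<noteq> lead_mon e" "x \<in> Poly_Mapping.keys (f e)"
      using xy(2) by (auto simp: r_def in_keys_iff lookup_minus lookup_single u_def when_def split: if_splits)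
    then have "weight w x < weight w (lead_mon e)"
      using lower[OF e] by simp
    moreover have "weight w y \<le> weight w k0"
      using top xy(3) by (simp add: top_monomial_def)
    moreover have "weight w (lead_mon e) + weight w k0 = weight w x + weight w y"
      using arg_cong[OF xy(1), of "weight w"] by simp
    ultimately show False
      by simp
  qed
  moreover have "f e * g = Poly_Mapping.single (lead_mon e) u * g + r * g"
    by (simp add: r_def flip: distrib_right)
  ultimately have "Poly_Mapping.lookup (f e * g) (lead_mon e + k0) = u * Poly_Mapping.lookup g k0"
    by (simp only: lookup_add lookup_single_times) (simp add: in_keys_iff)
  then show ?thesis
    using lead[OF e] top by (simp add: u_def top_monomial_def in_keys_iff)
qed

lemma J_insert:
  assumes "insert e S \<subseteq> E" "h \<in> J (insert e S)"
  obtains j g where "j \<in> J S" "g \<in> carrier R" "h = j + f e * g"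
proof -
  let ?K = "{j + f e * g | j g. j \<in> J S \<and> g \<in> carrier R}"
  have id: "ideal (J S) R" and fe: "f e \<in> carrier R"
    using assms by (auto intro: J_ideal f_carrier)
  have "ideal ?K R"
  proof (rule ideal_poly_ringI)
    show "?K \<subseteq> carrier R"
      using ideal_carrier[OF id] fe by (auto intro!: carrier_intros)
    show "0 \<in> ?K"
      using ideal_zero[OF id] by (intro CollectI exI[of _ 0]) auto
    show "p + q \<in> ?K" if p: "p \<in> ?K" and q: "q \<in> ?K" for p q
    proof -
      obtain j g j' g' where "p = j + f e * g" "q = j' + f e * g'" "j \<in> J S" "j' \<in> J S"
        "g \<in> carrier R" "g' \<in> carrier R"
        using p q by blast
      then show ?thesis
        by (intro CollectI exI[of _ "j + j'"] exI[of _ "g + g'"])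
          (auto simp: algebra_simps intro: ideal_add[OF id] carrier_add)
    qed
    show "q * p \<in> ?K" if p: "p \<in> ?K" and q: "q \<in> carrier R" for p q
    proof -
      obtain j g where "p = j + f e * g" "j \<in> J S" "g \<in> carrier R"
        using p by blast
      then show ?thesis
        using q by (intro CollectI exI[of _ "q * j"] exI[of _ "q * g"])
          (auto simp: distrib_left mult.left_commute intro: ideal_mult[OF id] carrier_mult)
    qed
  qed
  moreover have "f ` insert e S \<subseteq> ?K"
  proof
    fix x assume "x \<in> f ` insert e S"
    then consider "x = f e" | "x \<in> J S"
      using f_in_J[of S] assms(1) by auto
    then show "x \<in> ?K"
    proof cases
      case 1
      then show ?thesis
        using ideal_zero[OF id] by (intro CollectI exI[of _ 0] exI[of _ 1]) auto
    next
      case 2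
      then show ?thesis
        by (intro CollectI exI[of _ x] exI[of _ 0]) auto
    qed
  qed
  ultimately have "J (insert e S) \<subseteq> ?K"
    unfolding J_def by (rule ring.genideal_minimal[OF poly_ring_ring])
  then show ?thesis
    using assms(2) that by blast
qed

text \<open>By induction on \<open>S\<close>. An element of \<open>J (insert e S)\<close> is \<open>j + f e * g\<close> with \<open>j \<in> J S\<close>, and \<open>g\<close> may be
  taken in normal form modulo \<open>J S\<close>. The top monomials of \<open>f e * g\<close> are then the leading monomial of \<open>f e\<close>
  times those of \<open>g\<close>, and they are standard for \<open>S\<close> by coprimality, whereas those of \<open>j\<close> are
  nonstandard for \<open>S\<close> by induction. Hence they cannot cancel each other, and each top monomial of the
  sum is a top monomial of one of the two summands.\<close>

theorem top_monomial_nonstandard: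
  assumes "S \<subseteq> E" "h \<in> J S" "top_monomial h k"
  shows "\<not> standard S k"
proof -
  have "finite S"
    using assms(1) finite_E by (rule finite_subset)
  then show ?thesis
    using assms
  proof (induction S arbitrary: h k rule: finite_induct)
    case empty
    have "J {} \<subseteq> {0}"
      using ring.genideal_minimal[OF poly_ring_ring ring.zeroideal[OF poly_ring_ring], of "{}" V]
      by (simp add: J_def)
    then show ?case
      using empty by (auto simp: top_monomial_def)
  next
    case (insert e S)
    have e: "e \<in> E" and S: "S \<subseteq> E"
      using insert.prems by auto
    note id = J_ideal[OF S]
    obtain j0 g0 where j0: "j0 \<in> J S" "g0 \<in> carrier R" "h = j0 + f e * g0"
      using J_insert insert.prems by blast
    obtain g where g: "g \<in> carrier R" "g0 - g \<in> J S" "\<forall>k\<in>Poly_Mapping.keys g. standard S k"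
      using standard_representative[OF S j0(2)] .
    define j where "j = j0 + f e * (g0 - g)"
    have j: "j \<in> J S"
      unfolding j_def by (intro ideal_add[OF id] ideal_mult[OF id] j0 g f_carrier e)
    have h: "h = j + f e * g"
      by (simp add: j_def j0(3) right_diff_distrib)
    have top_j: "\<exists>k2\<in>Poly_Mapping.keys j. weight w k1 < weight w k2"
      if k1: "k1 \<in> Poly_Mapping.keys j" "standard S k1" for k1
    proof -
      obtain k2 where k2: "top_monomial j k2"
        using k1(1) by (rule exists_top_monomial)
      have "\<not> top_monomial j k1"
        using insert.IH[OF S j] k1(2) by blast
      then show ?thesis
        using k1(1) k2 unfolding top_monomial_def by (meson le_less_trans not_le)
    qed
    show ?case
    proof
      assume std: "standard (insert e S) k"
      have kh: "k \<in> Poly_Mapping.keys h" and kmax: "\<And>k'. k' \<in> Poly_Mapping.keys h \<Longrightarrow> weight w k' \<le> weight w k"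
        using insert.prems(3) by (auto simp: top_monomial_def)
      have stdS: "standard S k"
        using std by (simp add: standard_def)
      show False
      proof (cases "g = 0")
        case True
        then show False
          using insert.IH[OF S j] insert.prems(3) stdS h by simp
      next
        case False
        then obtain k' where "k' \<in> Poly_Mapping.keys g"
          by (metis ex_in_conv keys_eq_empty)
        then obtain k0 where k0: "top_monomial g k0"
          by (rule exists_top_monomial)
        let ?k1 = "lead_mon e + k0"
        have std1: "standard S ?k1"
          using g(3) k0 standard_lead_mon_add_iff[OF e S insert.hyps(2)] by (simp add: top_monomial_def)
        have high: "k2 \<in> Poly_Mapping.keys h"
          if "k2 \<in> Poly_Mapping.keys j" "weight w ?k1 < weight w k2" for k2
        proof -
          have "k2 \<notin> Poly_Mapping.keys (f e * g)"
            using keys_mult_lead[OF e k0, of k2] that(2) by auto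
          then show ?thesis
            using that(1) by (simp add: h in_keys_iff lookup_add)
        qed
        \<comment> \<open>The monomial \<open>?k1\<close> is one of the heaviest of \<open>f e * g\<close>; compare \<open>k\<close> with it.\<close>
        show False
        proof (cases "weight w k < weight w ?k1")
          case True
          then have "?k1 \<notin> Poly_Mapping.keys h"
            using kmax by (meson not_le)
          then have "?k1 \<in> Poly_Mapping.keys j"
            using lookup_mult_lead[OF e k0] by (auto simp: h in_keys_iff lookup_add)
          then obtain k2 where "k2 \<in> Poly_Mapping.keys j" "weight w ?k1 < weight w k2"
            using top_j std1 by blast
          then show False
            using high kmax True by (meson not_le less_trans)
        next
          case False
          have "k \<notin> Poly_Mapping.keys (f e * g)"
          proof
            assume "k \<in> Poly_Mapping.keys (f e * g)"
            then obtain k1 where "k = lead_mon e + k1"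
              using keys_mult_lead[OF e k0] False by blast
            then show False
              using std nonstandard_lead_mon_add[of e "insert e S"] by blast
          qed
          then have "k \<in> Poly_Mapping.keys j"
            using kh by (simp add: h in_keys_iff lookup_add)
          then obtain k2 where "k2 \<in> Poly_Mapping.keys j" "weight w k < weight w k2"
            using top_j stdS by blast
          then show False
            using high[of k2] kmax[of k2] False by auto
        qed
      qed
    qed
  qed
qed

text \<open>Only the normal form \<open>g\<close> of \<open>q\<close> matters. If it were not zero, the product \<open>f e * g\<close> would be an element
  of \<open>J S\<close> with a top monomial that is standard for \<open>S\<close>.\<close>

lemma lead_nonzerodivisor:
  assumes e: "e \<in> E" and S: "S \<subseteq> E" "e \<notin> S" and q: "q \<in> carrier R" and mult: "f e * q \<in> J S"
  shows "q \<in> J S"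
proof -
  note id = J_ideal[OF S(1)]
  obtain g where g: "g \<in> carrier R" "q - g \<in> J S" "\<forall>k\<in>Poly_Mapping.keys g. standard S k"
    using standard_representative[OF S(1) q] .
  have "g = 0"
  proof (rule ccontr)
    assume "g \<noteq> 0"
    then obtain k' where "k' \<in> Poly_Mapping.keys g"
      by (metis ex_in_conv keys_eq_empty)
    then obtain k0 where k0: "top_monomial g k0"
      by (rule exists_top_monomial)
    have "f e * q - f e * (q - g) \<in> J S"
      by (intro ideal_diff[OF id] ideal_mult[OF id] mult g f_carrier e)
    then have "f e * g \<in> J S"
      by (simp add: right_diff_distrib)
    moreover have "weight w k' \<le> weight w (lead_mon e + k0)" if "k' \<in> Poly_Mapping.keys (f e * g)" for k'
      using keys_mult_lead[OF e k0 that] by linarith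
    then have "top_monomial (f e * g) (lead_mon e + k0)"
      using lookup_mult_lead[OF e k0] by (simp add: top_monomial_def in_keys_iff)
    ultimately have "\<not> standard S (lead_mon e + k0)"
      by (rule top_monomial_nonstandard[OF S(1)])
    then show False
      using g(3) k0 standard_lead_mon_add_iff[OF e S] by (simp add: top_monomial_def)
  qed
  then show ?thesis
    using g(2) by simp
qed

lemma J_proper:
  assumes "S \<subseteq> E"
  shows "J S \<noteq> carrier R"
proof
  assume "J S = carrier R"
  then have "1 \<in> J S"
    by simp
  moreover have "top_monomial 1 0" "standard S 0"
    by (simp_all add: top_monomial_def standard_def)
  ultimately show False
    using top_monomial_nonstandard[OF assms] by blast
qed

theorem regular_sequence_map:
  assumes "distinct es" "set es = E"
  shows "regular_sequence R (map f es)"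
  unfolding regular_sequence_def
proof (intro conjI allI impI)
  show "set (map f es) \<subseteq> carrier R"
    using assms(2) f_carrier by auto
  show "Idl\<^bsub>R\<^esub> (set (map f es)) \<noteq> carrier R"
    using J_proper[of E] assms(2) by (simp add: J_def)
next
  fix i assume i: "i < length (map f es)"
  let ?S = "set (take i es)"
  have S: "?S \<subseteq> E" and e: "es ! i \<in> E"
    using i assms(2) set_take_subset by force+
  have "es ! i \<notin> ?S"
    using i assms(1) by (auto simp: in_set_conv_nth nth_eq_iff_index_eq)
  note nzd = lead_nonzerodivisor[OF e S this]
  interpret I: ideal "J ?S" R
    by (rule J_ideal[OF S])
  interpret h: ring_hom_ring R "R Quot (J ?S)" "(+>\<^bsub>R\<^esub>) (J ?S)"
    by (rule I.rcos_ring_hom_ring)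
  have fe: "f (es ! i) \<in> carrier R"
    by (rule f_carrier[OF e])
  have "nonzerodivisor (R Quot (J ?S)) (J ?S +>\<^bsub>R\<^esub> f (es ! i))"
    unfolding nonzerodivisor_def
  proof (intro conjI ballI impI)
    show "J ?S +>\<^bsub>R\<^esub> f (es ! i) \<in> carrier (R Quot J ?S)"
      by (rule h.hom_closed[OF fe])
    fix Y assume Y: "Y \<in> carrier (R Quot J ?S)"
      and zero: "(J ?S +>\<^bsub>R\<^esub> f (es ! i)) \<otimes>\<^bsub>R Quot J ?S\<^esub> Y = \<zero>\<^bsub>R Quot J ?S\<^esub>"
    obtain q where q: "q \<in> carrier R" "Y = J ?S +>\<^bsub>R\<^esub> q"
      using Y by (auto simp: FactRing_def A_RCOSETS_def')
    have "J ?S +>\<^bsub>R\<^esub> (f (es ! i) * q) = J ?S"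
      using zero h.hom_mult[OF fe q(1)] by (simp add: q(2) FactRing_def)
    then have "f (es ! i) * q \<in> J ?S"
      using ideal_coset_eq_self_iff[OF J_ideal[OF S]] fe q(1) by (simp add: carrier_mult)
    then have "q \<in> J ?S"
      by (rule nzd[OF q(1)])
    then show "Y = \<zero>\<^bsub>R Quot J ?S\<^esub>"
      using ideal_coset_eq_self_iff[OF J_ideal[OF S] q(1)] by (simp add: q(2) FactRing_def)
  qed
  then show "nonzerodivisor (R Quot (Idl\<^bsub>R\<^esub> (set (take i (map f es)))))
      (Idl\<^bsub>R\<^esub> (set (take i (map f es))) +>\<^bsub>R\<^esub> map f es ! i)"
    using i by (simp add: J_def take_map)
qed

text \<open>In a standard monomial one of the indeterminates \<open>a e\<close> and \<open>b e\<close> is absent for each \<open>e\<close>. After the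
  choice of the absent ones, which can be made in \<open>2 ^ card E\<close> ways, \<open>card V - card E\<close> indeterminates
  remain.\<close>

lemma card_standard:
  "finite {m. Poly_Mapping.keys m \<subseteq> V \<and> standard E m \<and> tdeg m \<le> t}" (is "finite ?B")
  "card {m. Poly_Mapping.keys m \<subseteq> V \<and> standard E m \<and> tdeg m \<le> t} \<le> 2 ^ card E * (t + 1) ^ (card V - card E)"
proof -
  let ?W = "\<lambda>T. V - (a ` T \<union> b ` (E - T))"
  let ?M = "\<lambda>T. {m. Poly_Mapping.keys m \<subseteq> ?W T \<and> (\<forall>v. Poly_Mapping.lookup m v \<le> t)}"
  have sub: "?B \<subseteq> (\<Union>T\<in>Pow E. ?M T)"
  proof
    fix m assume m: "m \<in> ?B"
    let ?T = "{e \<in> E. Poly_Mapping.lookup m (a e) = 0}"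
    have "v \<in> ?W ?T" if v: "v \<in> Poly_Mapping.keys m" for v
    proof -
      have "v \<noteq> a e" if "e \<in> ?T" for e
        using that v by (auto simp: in_keys_iff)
      moreover have "v \<noteq> b e" if "e \<in> E - ?T" for e
      proof -
        have "Poly_Mapping.lookup m (b e) = 0"
          using that m unfolding standard_def by blast
        then show ?thesis
          using v by (metis in_keys_iff)
      qed
      ultimately show ?thesis
        using v m by blast
    qed
    moreover have "Poly_Mapping.lookup m v \<le> t" for v
      using m lookup_le_tdeg[of m v] by simp
    ultimately have "m \<in> ?M ?T"
      by blast
    moreover have "?T \<in> Pow E"
      by blast
    ultimately show "m \<in> (\<Union>T\<in>Pow E. ?M T)"
      by (rule UN_I[rotated])
  qed
  have card_W: "card (?W T) = card V - card E" if "T \<subseteq> E" for T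
  proof -
    have "finite T"
      using that finite_E by (rule finite_subset)
    have "card (a ` T \<union> b ` (E - T)) = card (a ` T) + card (b ` (E - T))"
      using that disjoint \<open>finite T\<close> finite_E by (intro card_Un_disjoint) auto
    also have "\<dots> = card T + card (E - T)"
      using that inj_a inj_b by (simp add: card_image inj_on_subset)
    also have "\<dots> = card E"
      using that finite_E \<open>finite T\<close> by (simp add: card_Diff_subset card_mono)
    finally have "card (a ` T \<union> b ` (E - T)) = card E" .
    moreover have "a ` T \<union> b ` (E - T) \<subseteq> V"
      using that a_in b_in by auto
    ultimately show ?thesis
      by (metis card_Diff_subset finite_V finite_subset)
  qed
  have fin: "finite (\<Union>T\<in>Pow E. ?M T)"
    using finite_E finite_V by (intro finite_UN_I card_bounded_monomials) auto
  show "finite ?B"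
    by (rule finite_subset[OF sub fin])
  have "card ?B \<le> card (\<Union>T\<in>Pow E. ?M T)"
    by (rule card_mono[OF fin sub])
  also have "\<dots> \<le> (\<Sum>T\<in>Pow E. card (?M T))"
    using finite_E by (intro card_UN_le) simp
  also have "\<dots> \<le> (\<Sum>T\<in>Pow E. (t + 1) ^ (card V - card E))"
  proof (rule sum_mono)
    fix T assume "T \<in> Pow E"
    then show "card (?M T) \<le> (t + 1) ^ (card V - card E)"
      using card_bounded_monomials(2)[of "?W T" t] card_W[of T] finite_V by simp
  qed
  also have "\<dots> = 2 ^ card E * (t + 1) ^ (card V - card E)"
    using finite_E by (simp add: card_Pow)
  finally show "card ?B \<le> 2 ^ card E * (t + 1) ^ (card V - card E)" .
qed

theorem krull_dim_le: "krull_dim (R Quot J E) \<le> enat (card V - card E)"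
proof (rule krull_dim_quotient_le[OF J_ideal[OF order_refl]])
  fix t
  let ?B = "{m. Poly_Mapping.keys m \<subseteq> V \<and> standard E m \<and> tdeg m \<le> t}"
  have "\<exists>s. p - s \<in> J E \<and> Poly_Mapping.keys s \<subseteq> ?B" if p: "p \<in> carrier R" "deg_le t p" for p
  proof -
    obtain s where "s \<in> carrier R" "p - s \<in> J E" "\<forall>k\<in>Poly_Mapping.keys s. standard E k" "deg_le t s"
      using reducible_deg_le[OF order_refl p] unfolding reducible_def by blast
    then show ?thesis
      by (intro exI[of _ s]) (auto simp: poly_ring_carrier deg_le_def)
  qed
  then show "\<exists>B. finite B \<and> card B \<le> 2 ^ card E * (t + 1) ^ (card V - card E) \<and>
    (\<forall>p\<in>carrier R. deg_le t p \<longrightarrow> (\<exists>s. p - s \<in> J E \<and> Poly_Mapping.keys s \<subseteq> B))"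
    using card_standard[of t] by blast
qed

end

section \<open>Substitution\<close>

lemma const_mult: "const (c * d) = const c * const d"
  by (simp add: mult_single)

definition mon_subst :: "('v \<Rightarrow> ('u, 'k::comm_ring_1) mpoly) \<Rightarrow> ('v \<Rightarrow>\<^sub>0 nat) \<Rightarrow> ('u, 'k) mpoly" where
  "mon_subst \<phi> m = (\<Prod>v\<in>Poly_Mapping.keys m. \<phi> v ^ Poly_Mapping.lookup m v)"

definition subst :: "('v \<Rightarrow> ('u, 'k::comm_ring_1) mpoly) \<Rightarrow> ('v, 'k) mpoly \<Rightarrow> ('u, 'k) mpoly" where
  "subst \<phi> p = (\<Sum>m\<in>Poly_Mapping.keys p. const (Poly_Mapping.lookup p m) * mon_subst \<phi> m)"

lemma mon_subst_superset:
  assumes "finite A" "Poly_Mapping.keys m \<subseteq> A"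
  shows "mon_subst \<phi> m = (\<Prod>v\<in>A. \<phi> v ^ Poly_Mapping.lookup m v)"
  unfolding mon_subst_def
  by (rule prod.mono_neutral_left) (use assms in \<open>auto simp: in_keys_iff\<close>)

lemma mon_subst_add: "mon_subst \<phi> (m + m') = mon_subst \<phi> m * mon_subst \<phi> m'"
proof -
  let ?A = "Poly_Mapping.keys m \<union> Poly_Mapping.keys m'"
  have "Poly_Mapping.keys (m + m') \<subseteq> ?A"
    by (rule Poly_Mapping.keys_add)
  then show ?thesis
    by (simp add: mon_subst_superset[of ?A] lookup_add power_add prod.distrib)
qed

lemma subst_superset:
  assumes "finite A" "Poly_Mapping.keys p \<subseteq> A"
  shows "subst \<phi> p = (\<Sum>m\<in>A. const (Poly_Mapping.lookup p m) * mon_subst \<phi> m)"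
  unfolding subst_def
  by (rule sum.mono_neutral_left) (use assms in \<open>auto simp: in_keys_iff\<close>)

lemma subst_zero [simp]: "subst \<phi> 0 = 0"
  by (simp add: subst_def)

lemma subst_add: "subst \<phi> (p + q) = subst \<phi> p + subst \<phi> q"
proof -
  let ?A = "Poly_Mapping.keys p \<union> Poly_Mapping.keys q"
  have "Poly_Mapping.keys (p + q) \<subseteq> ?A"
    by (rule Poly_Mapping.keys_add)
  then show ?thesis
    by (simp add: subst_superset[of ?A] lookup_add single_add distrib_right sum.distrib)
qed

lemma subst_sum: "subst \<phi> (sum p A) = (\<Sum>x\<in>A. subst \<phi> (p x))"
  by (induction A rule: infinite_finite_induct) (simp_all add: subst_add)

lemma subst_single: "subst \<phi> (Poly_Mapping.single m c) = const c * mon_subst \<phi> m"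
  by (cases "c = 0") (simp_all add: subst_def)

lemma subst_const [simp]: "subst \<phi> (const c) = const c"
  by (simp add: subst_single mon_subst_def)

lemma subst_one [simp]: "subst \<phi> 1 = 1"
  using subst_const[of \<phi> 1] by simp

lemma subst_indet [simp]: "subst \<phi> (indet v) = \<phi> v"
  by (simp add: indet_def subst_single mon_subst_def)

lemma subst_mult: "subst \<phi> (p * q) = subst \<phi> p * subst \<phi> q"
proof -
  let ?s = "\<lambda>p k. Poly_Mapping.single k (Poly_Mapping.lookup p k)"
  have "p * q = (\<Sum>k\<in>Poly_Mapping.keys p. \<Sum>l\<in>Poly_Mapping.keys q. ?s p k * ?s q l)"
    by (subst mpoly_eq_sum_single[of p], subst mpoly_eq_sum_single[of q]) (rule sum_product)
  then have "subst \<phi> (p * q) = (\<Sum>k\<in>Poly_Mapping.keys p. \<Sum>l\<in>Poly_Mapping.keys q. subst \<phi> (?s p k * ?s q l))"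
    by (simp only: subst_sum)
  also have "\<dots> = (\<Sum>k\<in>Poly_Mapping.keys p. \<Sum>l\<in>Poly_Mapping.keys q.
      (const (Poly_Mapping.lookup p k) * mon_subst \<phi> k) * (const (Poly_Mapping.lookup q l) * mon_subst \<phi> l))"
    by (intro sum.cong refl)
      (simp only: mult_single subst_single mon_subst_add const_mult ac_simps)
  also have "\<dots> = subst \<phi> p * subst \<phi> q"
    unfolding subst_def by (rule sum_product[symmetric])
  finally show ?thesis .
qed

lemma subst_uminus: "subst \<phi> (- p) = - subst \<phi> p"
  using subst_add[of \<phi> p "- p"] by (simp add: eq_neg_iff_add_eq_0 add.commute)

lemma subst_diff: "subst \<phi> (p - q) = subst \<phi> p - subst \<phi> q"
  using subst_add[of \<phi> p "- q"] by (simp add: subst_uminus)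

lemma subst_power: "subst \<phi> (p ^ k) = subst \<phi> p ^ k"
  by (induction k) (simp_all add: subst_mult)

lemma subst_prod: "subst \<phi> (prod p A) = (\<Prod>x\<in>A. subst \<phi> (p x))"
  by (induction A rule: infinite_finite_induct) (simp_all add: subst_mult)

lemma subst_subst: "subst \<psi> (subst \<phi> p) = subst (\<lambda>v. subst \<psi> (\<phi> v)) p"
  unfolding subst_def[of \<phi>] subst_def[of "\<lambda>v. subst \<psi> (\<phi> v)"] mon_subst_def
  by (simp add: subst_sum subst_mult subst_prod subst_power)

lemma subst_comm_ring_hom: "comm_ring_hom (subst \<phi>)"
  by unfold_locales (simp_all add: subst_add subst_mult)

section \<open>Chains of primes from a parametrization\<close>

lemma kernel_subst_ideal:
  "ideal {g \<in> carrier (poly_ring V). subst \<phi> g = 0} (poly_ring V)"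
  by (rule ideal_poly_ringI) (auto simp: subst_add subst_mult intro: carrier_intros)

text \<open>The order on the indeterminates of the target makes the target an integral domain.\<close>

lemma kernel_subst_primeideal:
  fixes \<phi> :: "'v \<Rightarrow> ('u::linorder, 'k::field) mpoly"
  shows "primeideal {g \<in> carrier (poly_ring V). subst \<phi> g = 0} (poly_ring V)"
proof (rule primeidealI[OF kernel_subst_ideal poly_ring_cring])
  have "1 \<notin> {g \<in> carrier (poly_ring V). subst \<phi> g = 0}"
    by simp
  then show "carrier (poly_ring V) \<noteq> {g \<in> carrier (poly_ring V). subst \<phi> g = 0}"
    using carrier_one by blast
qed (auto simp: subst_mult)

text \<open>A polynomial map \<open>\<Xi>\<close> parametrizes part of the zero set of \<open>I\<close>, with parameters \<open>Z\<close>. Give the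
  parameters one by one their values at the point \<open>p\<close>, and let \<open>P k\<close> consist of the polynomials whose
  composition with \<open>\<Xi>\<close> vanishes after \<open>k\<close> parameters have been fixed. These are primes above \<open>I\<close>, being kernels of
  substitutions into an integral domain, and they increase with \<open>k\<close>. The inclusions are strict if each
  parameter \<open>z\<close> can be recovered: composition with \<open>\<Xi>\<close> turns some polynomial into \<open>z - p z\<close> times a
  factor that is not zero at \<open>p\<close>, so that it vanishes when \<open>z\<close> is fixed and not before.\<close>

theorem krull_dim_quotient_ge_parametrization:
  fixes I :: "('v, 'k::field) mpoly set" and \<Xi> :: "'v \<Rightarrow> ('z, 'k) mpoly"
  assumes I: "ideal I (poly_ring V)" and "finite Z"
    and kills: "\<And>g. g \<in> I \<Longrightarrow> subst \<Xi> g = 0"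
    and witness: "\<And>z. z \<in> Z \<Longrightarrow> \<exists>g\<in>carrier (poly_ring V). \<exists>h.
      subst \<Xi> g = h * (indet z - const (p z)) \<and> subst (\<lambda>v. const (p v) :: (nat, 'k) mpoly) h \<noteq> 0"
  shows "enat (card Z) \<le> krull_dim (poly_ring V Quot I)"
proof -
  obtain num where num: "bij_betw num Z {0..<card Z}"
    using ex_bij_betw_finite_nat[OF \<open>finite Z\<close>] by blast
  define nth where "nth = inv_into Z num"
  have nth_num: "nth (num z) = z" if "z \<in> Z" for z
    using num that unfolding nth_def by (simp add: bij_betw_inv_into_left)
  have nth: "nth k \<in> Z" "num (nth k) = k" if "k < card Z" for k
    using num that unfolding nth_def
    by (auto simp: bij_betw_inv_into_right bij_betw_def intro!: inv_into_into)
  \<comment> \<open>The parameters with a number below \<open>k\<close> are fixed; \<open>\<sigma> k\<close> fixes the next one.\<close>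
  define \<rho> :: "nat \<Rightarrow> 'z \<Rightarrow> (nat, 'k) mpoly" where
    "\<rho> k v = (if v \<in> Z \<and> k \<le> num v then indet (num v) else const (p v))" for k v
  define \<sigma> :: "nat \<Rightarrow> nat \<Rightarrow> (nat, 'k) mpoly" where
    "\<sigma> k i = (if i = k then const (p (nth k)) else indet i)" for k i
  have step: "subst (\<sigma> k) (\<rho> k v) = \<rho> (Suc k) v" for k v
    using nth_num[of v] by (cases "num v = k") (auto simp: \<rho>_def \<sigma>_def)
  \<comment> \<open>Fixing all parameters, whatever has been fixed before.\<close>
  have full: "subst (\<lambda>i. const (p (nth i))) (\<rho> k v) = (const (p v) :: (nat, 'k) mpoly)" for k v
    using nth_num[of v] by (auto simp: \<rho>_def)
  define P where "P k = {g \<in> carrier (poly_ring V). subst (\<lambda>v. subst (\<rho> k) (\<Xi> v)) g = 0}" for k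
  have P_iff: "g \<in> P k \<longleftrightarrow> g \<in> carrier (poly_ring V) \<and> subst (\<rho> k) (subst \<Xi> g) = 0" for g k
    by (simp add: P_def subst_subst)
  show ?thesis
  proof (rule krull_dim_quotient_ge[OF I])
    show "primeideal (P k) (poly_ring V)" for k
      unfolding P_def by (rule kernel_subst_primeideal)
    show "I \<subseteq> P k" for k
      using kills ideal_carrier[OF I] by (auto simp: P_iff)
    show "P k \<subset> P (Suc k)" if k: "k < card Z" for k
    proof
      show "P k \<subseteq> P (Suc k)"
      proof
        fix g assume "g \<in> P k"
        then have g: "g \<in> carrier (poly_ring V)" "subst (\<sigma> k) (subst (\<rho> k) (subst \<Xi> g)) = 0"
          by (simp_all add: P_iff)
        have "subst (\<sigma> k) (subst (\<rho> k) (subst \<Xi> g)) = subst (\<rho> (Suc k)) (subst \<Xi> g)"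
          by (simp only: subst_subst[of "\<sigma> k" "\<rho> k"] step)
        then show "g \<in> P (Suc k)"
          using g by (simp add: P_iff)
      qed
      obtain g h where g: "g \<in> carrier (poly_ring V)"
        and gh: "subst \<Xi> g = h * (indet (nth k) - const (p (nth k)))"
        and h: "subst (\<lambda>v. const (p v) :: (nat, 'k) mpoly) h \<noteq> 0"
        using witness[OF nth(1)[OF k]] by blast
      have "subst (\<rho> k) h \<noteq> 0"
      proof
        assume "subst (\<rho> k) h = 0"
        then have "subst (\<lambda>i. const (p (nth i))) (subst (\<rho> k) h) = (0 :: (nat, 'k) mpoly)"
          by simp
        then show False
          using h by (simp only: subst_subst full)
      qed
      moreover have "indet k - const (p (nth k)) \<noteq> (0 :: (nat, 'k) mpoly)"
      proof
        assume "indet k - const (p (nth k)) = (0 :: (nat, 'k) mpoly)"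
        then have "Poly_Mapping.lookup (indet k - const (p (nth k)) :: (nat, 'k) mpoly) (Poly_Mapping.single k 1) = 0"
          by simp
        moreover have "Poly_Mapping.single k 1 \<noteq> (0 :: nat \<Rightarrow>\<^sub>0 nat)"
          by (metis lookup_single_eq lookup_zero one_neq_zero)
        ultimately show False
          by (simp add: indet_def lookup_minus lookup_single when_def)
      qed
      ultimately have "g \<notin> P k"
        using nth[OF k] by (simp add: P_iff gh subst_mult subst_diff \<rho>_def)
      moreover have "g \<in> P (Suc k)"
        using g nth[OF k] by (simp add: P_iff gh subst_mult subst_diff \<rho>_def)
      ultimately show "P k \<noteq> P (Suc k)"
        by blast
    qed
  qed
qed

section \<open>The entries of a commutator\<close>

definition commutator_entry :: "nat \<Rightarrow> (nat \<Rightarrow> nat \<Rightarrow> 'a::comm_ring_1) \<Rightarrow> (nat \<Rightarrow> nat \<Rightarrow> 'a) \<Rightarrow> nat \<times> nat \<Rightarrow> 'a" where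
  "commutator_entry n x y e = (\<Sum>k<n. x (fst e) k * y k (snd e) - y (fst e) k * x k (snd e))"

definition generic_entry :: "nat \<Rightarrow> nat \<times> nat \<Rightarrow> (entry, 'k::comm_ring_1) mpoly" where
  "generic_entry n = commutator_entry n (\<lambda>i j. indet (X_entry i j)) (\<lambda>i j. indet (Y_entry i j))"

text \<open>The positions of the given generators, without repetition at the centre of \<open>C\<close> and without \<open>(0, 0)\<close>:
  as the trace of a commutator is zero, one diagonal entry is redundant.\<close>

definition equations :: "nat \<Rightarrow> (nat \<times> nat) set" where
  "equations n = (\<lambda>i. (i, i)) ` {0<..<n} \<union> (\<lambda>i. (i, n - 1 - i)) ` {i. i < n \<and> i \<noteq> n - 1 - i}"

lemma equations_iff:
  "(i, j) \<in> equations n \<longleftrightarrow> i < n \<and> j < n \<and> (i = j \<and> 0 < i \<or> i \<noteq> j \<and> i + j = n - 1)"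
  by (auto simp: equations_def image_iff)

lemma finite_equations [simp]: "finite (equations n)"
  by (simp add: equations_def)

lemma card_equations:
  assumes "n \<ge> 1"
  shows "card (equations n) = (if odd n then 2 * n - 2 else 2 * n - 1)"
proof -
  have "card (equations n) = card ((\<lambda>i. (i, i)) ` {0<..<n}) + card ((\<lambda>i. (i, n - 1 - i)) ` {i. i < n \<and> i \<noteq> n - 1 - i})"
    unfolding equations_def by (rule card_Un_disjoint) auto
  also have "card ((\<lambda>i. (i, i)) ` {0<..<n}) = n - 1"
    by (subst card_image) (auto simp: inj_on_def)
  also have "card ((\<lambda>i. (i, n - 1 - i)) ` {i. i < n \<and> i \<noteq> n - 1 - i}) = card {i. i < n \<and> i \<noteq> n - 1 - i}"
    by (rule card_image) (auto simp: inj_on_def)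
  also have "{i. i < n \<and> i \<noteq> n - 1 - i} = (if odd n then {..<n} - {n div 2} else {..<n})"
    using assms by (cases "odd n") (auto elim!: oddE evenE, presburger)
  also have "card \<dots> = (if odd n then n - 1 else n)"
    using assms by (auto simp: card_Diff_singleton)
  finally show ?thesis
    using assms by auto
qed

lemma finite_entries: "finite (entries n)"
  and card_entries: "card (entries n) = 2 * n\<^sup>2"
proof -
  have eq: "entries n = case_prod X_entry ` ({..<n} \<times> {..<n}) \<union> case_prod Y_entry ` ({..<n} \<times> {..<n})"
    by (auto simp: entries_def)
  show "finite (entries n)"
    unfolding eq by simp
  have "card (entries n) = card (case_prod X_entry ` ({..<n} \<times> {..<n})) + card (case_prod Y_entry ` ({..<n} \<times> {..<n}))"
    unfolding eq by (rule card_Un_disjoint) auto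
  also have "\<dots> = card ({..<n} \<times> {..<n}) + card ({..<n} \<times> {..<n})"
    by (intro arg_cong2[where f = "(+)"] card_image) (auto simp: inj_on_def)
  finally show "card (entries n) = 2 * n\<^sup>2"
    by (simp add: power2_eq_square)
qed

lemma X_entry_in [simp]: "X_entry i j \<in> entries n \<longleftrightarrow> i < n \<and> j < n"
  and Y_entry_in [simp]: "Y_entry i j \<in> entries n \<longleftrightarrow> i < n \<and> j < n"
  by (auto simp: entries_def)

lemma generic_commutator:
  assumes "i < n" "j < n"
  shows "(generic_X n * generic_Y n - generic_Y n * generic_X n) $$ (i, j) = generic_entry n (i, j)"
  using assms
  by (simp add: generic_X_def generic_Y_def generic_entry_def commutator_entry_def scalar_prod_def
      sum_subtractf lessThan_atLeast0)

lemma subst_commutator_entry: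
  "subst \<phi> (commutator_entry n x y e) =
    commutator_entry n (\<lambda>i j. subst \<phi> (x i j)) (\<lambda>i j. subst \<phi> (y i j)) e"
  by (simp add: commutator_entry_def subst_sum subst_diff subst_mult)

lemma commutator_entry_cmult:
  "commutator_entry n x (\<lambda>i j. c * y i j) e = c * commutator_entry n x y e"
  by (simp add: commutator_entry_def sum_distrib_left right_diff_distrib ac_simps)

lemma commutator_entry_add:
  "commutator_entry n x (\<lambda>i j. y i j + y' i j) e = commutator_entry n x y e + commutator_entry n x y' e"
  by (simp add: commutator_entry_def algebra_simps flip: sum.distrib)

lemma commutator_entry_sum:
  "commutator_entry n x (\<lambda>i j. \<Sum>t\<in>A. y t i j) e = (\<Sum>t\<in>A. commutator_entry n x (y t) e)"
proof (induction A rule: infinite_finite_induct)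
  case (insert t A)
  then show ?case
    by (simp add: commutator_entry_add)
qed (simp_all add: commutator_entry_def)

lemma generic_entry_carrier:
  assumes "fst e < n" "snd e < n"
  shows "generic_entry n e \<in> carrier (poly_ring (entries n))"
  unfolding generic_entry_def commutator_entry_def
  by (intro carrier_intros) (use assms in auto)

lemma commutator_trace: "(\<Sum>i<n. commutator_entry n x y (i, i)) = 0"
proof -
  have "(\<Sum>i<n. commutator_entry n x y (i, i)) = (\<Sum>i<n. \<Sum>k<n. x i k * y k i) - (\<Sum>i<n. \<Sum>k<n. x k i * y i k)"
    by (simp add: commutator_entry_def sum_subtractf mult.commute)
  also have "(\<Sum>i<n. \<Sum>k<n. x k i * y i k) = (\<Sum>i<n. \<Sum>k<n. x i k * y k i)"
    by (rule sum.swap)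
  finally show ?thesis
    by simp
qed

lemma equations_generate:
  fixes G :: "(entry, 'k::comm_ring_1) mpoly set"
  assumes "n \<ge> 1"
    and G: "G = {generic_entry n (i, i) | i. i < n} \<union> {generic_entry n (i, n - 1 - i) | i. i < n}"
  shows "Idl\<^bsub>poly_ring (entries n)\<^esub> (generic_entry n ` equations n) = Idl\<^bsub>poly_ring (entries n)\<^esub> G"
proof
  let ?R = "poly_ring (entries n) :: (entry, 'k) mpoly ring"
  let ?J = "Idl\<^bsub>?R\<^esub> (generic_entry n ` equations n)"
  have G_carrier: "G \<subseteq> carrier ?R"
    unfolding G by (auto intro!: generic_entry_carrier)
  have sub: "generic_entry n ` equations n \<subseteq> G"
    unfolding G equations_def by auto
  have id: "ideal ?J ?R"
    using sub G_carrier by (intro ring.genideal_ideal[OF poly_ring_ring]) blast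
  have gen: "generic_entry n e \<in> ?J" if "e \<in> equations n" for e
    using ring.genideal_self[OF poly_ring_ring order_trans[OF sub G_carrier]] that by blast
  show "?J \<subseteq> Idl\<^bsub>?R\<^esub> G"
    using sub ring.genideal_self[OF poly_ring_ring G_carrier]
    by (intro ring.genideal_minimal[OF poly_ring_ring ring.genideal_ideal[OF poly_ring_ring G_carrier]]) blast
  have "(\<Sum>i<n. generic_entry n (i, i)) = (0 :: (entry, 'k) mpoly)"
    unfolding generic_entry_def by (rule commutator_trace)
  moreover have "{..<n} = insert 0 {0<..<n}"
    using assms(1) by auto
  ultimately have "generic_entry n (0, 0) = - (\<Sum>i\<in>{0<..<n}. generic_entry n (i, i) :: (entry, 'k) mpoly)"
    by (simp add: eq_neg_iff_add_eq_0)
  also have "\<dots> \<in> ?J"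
    by (intro ideal_uminus[OF id] ideal_sum[OF id] gen) (auto simp: equations_iff)
  finally have zero: "generic_entry n (0, 0) \<in> ?J" .
  have diag: "generic_entry n (i, i) \<in> ?J" if "i < n" for i
    using that zero gen[of "(i, i)"] by (cases "i = 0") (simp_all add: equations_iff)
  have "generic_entry n (i, n - 1 - i) \<in> ?J" if "i < n" for i
    using that diag[of i] gen[of "(i, n - 1 - i)"] by (cases "i = n - 1 - i") (simp_all add: equations_iff)
  then have "G \<subseteq> ?J"
    using diag unfolding G by auto
  then show "Idl\<^bsub>?R\<^esub> G \<subseteq> ?J"
    by (rule ring.genideal_minimal[OF poly_ring_ring id])
qed

section \<open>Leading monomials of the entries of the generic commutator\<close>

text \<open>The leading monomial of the generator at \<open>(i, j)\<close> is the product of the following entries of \<open>X\<close> and of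
  \<open>Y\<close>. A product \<open>x\<^sub>i\<^sub>k y\<^sub>k\<^sub>i\<close> occurs in the diagonal entries at \<open>i\<close> and at \<open>k\<close> and in no other one, so
  leading monomials for the diagonal are found by joining each \<open>i > 0\<close> to a parent \<open>k\<close> in a tree with
  root \<open>0\<close>. The tree must not contain an edge between \<open>i\<close> and \<open>n - 1 - i\<close>, as the entries at these
  positions serve the anti-diagonal generators, where they are multiplied with diagonal entries of \<open>X\<close>
  or \<open>Y\<close>. The tree used here joins \<open>n - 1\<close> to \<open>1\<close> and everything else to \<open>0\<close>; this is possible
  since \<open>n \<ge> 3\<close>.\<close>

fun lead_X :: "nat \<Rightarrow> nat \<times> nat \<Rightarrow> entry" where
  "lead_X n (i, j) =
    (if i = j then (if i = n - 1 then X_entry i 1 else X_entry i 0)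
     else if i < j then X_entry i j else X_entry j j)"

fun lead_Y :: "nat \<Rightarrow> nat \<times> nat \<Rightarrow> entry" where
  "lead_Y n (i, j) =
    (if i = j then (if i = n - 1 then Y_entry 1 i else Y_entry 0 i)
     else if i < j then Y_entry i i else Y_entry i j)"

text \<open>The value \<open>10\<close> exceeds all weights of products without diagonal entries, which are at most \<open>6\<close>. In an
  anti-diagonal generator it leaves two candidates, one with a diagonal entry of \<open>X\<close> and one with a
  diagonal entry of \<open>Y\<close>, and the value \<open>1\<close> decides between them. On the diagonal, the products
  that belong to the tree have weight \<open>6\<close>, or \<open>4\<close> for the edge between \<open>n - 1\<close> and \<open>1\<close>: that product
  also occurs in the generator at \<open>(1, 1)\<close>, where it must not dominate.\<close>

fun entry_weight :: "nat \<Rightarrow> entry \<Rightarrow> nat" where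
  "entry_weight n (X_entry i j) =
    (if i = j then (if 2 * i < n - 1 then 10 else 0)
     else if i + j = n - 1 then (if i < j then 1 else 0)
     else if i = n - 1 then (if j = 1 then 2 else 0)
     else if j = 0 then 3 else 0)"
| "entry_weight n (Y_entry i j) =
    (if i = j then (if 2 * i < n - 1 then 10 else 0)
     else if i + j = n - 1 then (if j < i then 1 else 0)
     else if j = n - 1 then (if i = 1 then 2 else 0)
     else if i = 0 then 3 else 0)"

definition XY_monomial :: "nat \<Rightarrow> nat \<Rightarrow> nat \<Rightarrow> nat \<Rightarrow> entry \<Rightarrow>\<^sub>0 nat" where
  "XY_monomial i j k l =
    Poly_Mapping.single (X_entry i j) 1 + Poly_Mapping.single (Y_entry k l) 1"

lemma XY_monomial_eq_iff [simp]:
  "XY_monomial i j k l = XY_monomial i' j' k' l' \<longleftrightarrow> i = i' \<and> j = j' \<and> k = k' \<and> l = l'"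
proof
  assume eq: "XY_monomial i j k l = XY_monomial i' j' k' l'"
  have "Poly_Mapping.lookup (XY_monomial i j k l) (X_entry i' j') = 1"
    "Poly_Mapping.lookup (XY_monomial i j k l) (Y_entry k' l') = 1"
    unfolding eq by (simp_all add: XY_monomial_def lookup_add lookup_single)
  then show "i = i' \<and> j = j' \<and> k = k' \<and> l = l'"
    by (auto simp: XY_monomial_def lookup_add lookup_single when_def split: if_splits)
qed simp

lemma weight_XY_monomial [simp]: "weight w (XY_monomial i j k l) = w (X_entry i j) + w (Y_entry k l)"
  by (simp add: XY_monomial_def)

lemma lead_monomial:
  "Poly_Mapping.single (lead_X n (i, j)) 1 + Poly_Mapping.single (lead_Y n (i, j)) 1 =
    (if i = j then XY_monomial i (if i = n - 1 then 1 else 0) (if i = n - 1 then 1 else 0) j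
     else if i < j then XY_monomial i j i i else XY_monomial j j i j)"
  by (simp add: XY_monomial_def)

text \<open>In a diagonal entry of the commutator, the two products for \<open>k = i\<close> cancel.\<close>

definition summands :: "nat \<Rightarrow> nat \<times> nat \<Rightarrow> nat set" where
  "summands n e = {k. k < n \<and> (fst e = snd e \<longrightarrow> k \<noteq> fst e)}"

lemma generic_entry_expand:
  "generic_entry n e = (\<Sum>k\<in>summands n e.
    Poly_Mapping.single (XY_monomial (fst e) k k (snd e)) 1 -
    Poly_Mapping.single (XY_monomial k (snd e) (fst e) k) 1)"
proof -
  have "generic_entry n e = (\<Sum>k<n.
      Poly_Mapping.single (XY_monomial (fst e) k k (snd e)) 1 -
      Poly_Mapping.single (XY_monomial k (snd e) (fst e) k) 1)"
    by (simp add: generic_entry_def commutator_entry_def indet_def mult_single XY_monomial_def add.commute)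
  also have "\<dots> = (\<Sum>k\<in>summands n e.
      Poly_Mapping.single (XY_monomial (fst e) k k (snd e)) 1 -
      Poly_Mapping.single (XY_monomial k (snd e) (fst e) k) 1)"
    by (rule sum.mono_neutral_right) (auto simp: summands_def)
  finally show ?thesis .
qed

lemma keys_generic_entry:
  assumes "m \<in> Poly_Mapping.keys (generic_entry n e :: (entry, 'k::comm_ring_1) mpoly)"
  obtains k where "k \<in> summands n e"
    "m = XY_monomial (fst e) k k (snd e) \<or> m = XY_monomial k (snd e) (fst e) k"
proof -
  have "\<exists>k\<in>summands n e. m = XY_monomial (fst e) k k (snd e) \<or> m = XY_monomial k (snd e) (fst e) k"
  proof (rule ccontr)
    assume "\<not> ?thesis"
    then have "Poly_Mapping.lookup (generic_entry n e :: (entry, 'k) mpoly) m = 0"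
      unfolding generic_entry_expand lookup_sum lookup_minus lookup_single
      by (intro sum.neutral) (auto simp: when_def)
    then show False
      using assms by (simp add: in_keys_iff)
  qed
  then show ?thesis
    using that by blast
qed

lemma lookup_generic_entry:
  assumes "k \<in> summands n (i, j)"
  shows "Poly_Mapping.lookup (generic_entry n (i, j) :: (entry, 'k::comm_ring_1) mpoly) (XY_monomial i k k j) = 1"
    and "Poly_Mapping.lookup (generic_entry n (i, j) :: (entry, 'k::comm_ring_1) mpoly) (XY_monomial k j i k) = - 1"
proof -
  let ?g = "generic_entry n (i, j) :: (entry, 'k) mpoly"
  have fin: "finite (summands n (i, j))"
    by (simp add: summands_def)
  have neq: "XY_monomial i l l j \<noteq> XY_monomial l' j i l'"
    if "l \<in> summands n (i, j)" for l l'
    using that unfolding XY_monomial_eq_iff summands_def by auto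
  have lookup: "Poly_Mapping.lookup ?g m = (\<Sum>l\<in>summands n (i, j).
      (1 when XY_monomial i l l j = m) - (1 when XY_monomial l j i l = m))" for m
    unfolding generic_entry_expand lookup_sum lookup_minus lookup_single by simp
  have "Poly_Mapping.lookup ?g (XY_monomial i k k j) = (\<Sum>l\<in>summands n (i, j). if l = k then 1 else 0)"
    unfolding lookup
  proof (rule sum.cong[OF refl])
    fix l assume "l \<in> summands n (i, j)"
    show "(1 when XY_monomial i l l j = XY_monomial i k k j) - (1 when XY_monomial l j i l = XY_monomial i k k j) =
        (if l = k then 1 else 0 :: 'k)"
      using neq[OF assms, of l] by (cases "l = k") (auto simp: when_def)
  qed
  then show "Poly_Mapping.lookup ?g (XY_monomial i k k j) = 1"
    using assms fin by simp
  have "Poly_Mapping.lookup ?g (XY_monomial k j i k) = (\<Sum>l\<in>summands n (i, j). if l = k then - 1 else 0)"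
    unfolding lookup
  proof (rule sum.cong[OF refl])
    fix l assume "l \<in> summands n (i, j)"
    then show "(1 when XY_monomial i l l j = XY_monomial k j i k) - (1 when XY_monomial l j i l = XY_monomial k j i k) =
        (if l = k then - 1 else 0 :: 'k)"
      using neq[of l k] by (cases "l = k") (simp_all add: when_def)
  qed
  then show "Poly_Mapping.lookup ?g (XY_monomial k j i k) = - 1"
    using assms fin by simp
qed

lemma entry_weight_bounds:
  assumes "p \<noteq> q"
  shows "entry_weight n (X_entry p q) \<le> 3" "entry_weight n (Y_entry p q) \<le> 3"
    and "q \<noteq> 0 \<Longrightarrow> entry_weight n (X_entry p q) \<le> 2" "p \<noteq> 0 \<Longrightarrow> entry_weight n (Y_entry p q) \<le> 2"
    and "q \<noteq> 0 \<Longrightarrow> p \<noteq> n - 1 \<or> q \<noteq> 1 \<Longrightarrow> entry_weight n (X_entry p q) \<le> 1"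
    and "p \<noteq> 0 \<Longrightarrow> q \<noteq> n - 1 \<or> p \<noteq> 1 \<Longrightarrow> entry_weight n (Y_entry p q) \<le> 1"
  using assms by auto

lemma lead_monomial_heaviest:
  assumes "n \<ge> 3" "(i, j) \<in> equations n" "k \<in> summands n (i, j)"
    and m: "m = XY_monomial i k k j \<or> m = XY_monomial k j i k"
    and neq: "m \<noteq> Poly_Mapping.single (lead_X n (i, j)) 1 + Poly_Mapping.single (lead_Y n (i, j)) 1"
  shows "weight (entry_weight n) m < entry_weight n (lead_X n (i, j)) + entry_weight n (lead_Y n (i, j))"
proof -
  let ?w = "entry_weight n"
  let ?L = "?w (lead_X n (i, j)) + ?w (lead_Y n (i, j))"
  have ij: "i < n" "j < n" "i = j \<and> 0 < i \<or> i \<noteq> j \<and> i + j = n - 1"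
    using assms(2) unfolding equations_iff by auto
  have k: "k < n" "i = j \<Longrightarrow> k \<noteq> i"
    using assms(3) by (auto simp: summands_def)
  note neq' = neq[unfolded lead_monomial]
  consider "i = j" "n - 1 \<noteq> i" | "i = j" "n - 1 = i" | "i < j" "i + j = n - 1" | "j < i" "i + j = n - 1"
    using ij by linarith
  then show ?thesis
  proof cases
    case 1
    have i: "i \<noteq> 0" "k \<noteq> i"
      using 1 ij k by auto
    have L: "?L = 6"
      using 1 i by simp
    show ?thesis
      using m
    proof
      assume P: "m = XY_monomial i k k j"
      then have "k \<noteq> 0"
        using neq' 1 by auto
      then have "?w (X_entry i k) \<le> 1" "?w (Y_entry k i) \<le> 1"
        using entry_weight_bounds(5)[of i k n] entry_weight_bounds(6)[of k i n] i 1 by auto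
      then show ?thesis
        unfolding L unfolding P weight_XY_monomial \<open>i = j\<close>[symmetric] by linarith
    next
      assume Q: "m = XY_monomial k j i k"
      have "?w (X_entry k i) \<le> 2" "?w (Y_entry i k) \<le> 2"
        using entry_weight_bounds(3)[of k i n] entry_weight_bounds(4)[of i k n] i by auto
      then show ?thesis
        unfolding L unfolding Q weight_XY_monomial \<open>i = j\<close>[symmetric] by linarith
    qed
  next
    case 2
    have i: "i \<ge> 2" "k \<noteq> i"
      using 2 assms(1) k by auto
    have L: "?L = 4"
      using 2 i by simp
    show ?thesis
      using m
    proof
      assume P: "m = XY_monomial i k k j"
      then have "k \<noteq> 1"
        using neq' 2 by auto
      then have "?w (X_entry i k) = 0" "?w (Y_entry k i) = 0"
        using i 2 by auto
      then show ?thesis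
        unfolding L unfolding P weight_XY_monomial \<open>i = j\<close>[symmetric] by linarith
    next
      assume Q: "m = XY_monomial k j i k"
      have "?w (X_entry k i) \<le> 1" "?w (Y_entry i k) \<le> 1"
        using entry_weight_bounds(5)[of k i n] entry_weight_bounds(6)[of i k n] i 2 by auto
      then show ?thesis
        unfolding L unfolding Q weight_XY_monomial \<open>i = j\<close>[symmetric] by linarith
    qed
  next
    case 3
    have L: "?L = 11"
      using 3 by simp
    have off: "?w (X_entry i k) + ?w (Y_entry k j) \<le> 6" "?w (X_entry k j) + ?w (Y_entry i k) \<le> 6"
      if "k \<noteq> i" "k \<noteq> j"
      using that entry_weight_bounds(1,2)[of i k n] entry_weight_bounds(1,2)[of k j n] by auto
    show ?thesis
      using m
    proof
      assume P: "m = XY_monomial i k k j"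
      consider "k = i" | "k = j" | "k \<noteq> i" "k \<noteq> j"
        by blast
      then show ?thesis
        using 3 off P unfolding L by cases simp_all
    next
      assume Q: "m = XY_monomial k j i k"
      then have "k \<noteq> i"
        using neq' 3 by auto
      then consider "k = j" | "k \<noteq> i" "k \<noteq> j"
        by blast
      then show ?thesis
        using 3 off Q unfolding L by cases simp_all
    qed
  next
    case 4
    have L: "?L = 11"
      using 4 by simp
    have off: "?w (X_entry i k) + ?w (Y_entry k j) \<le> 6" "?w (X_entry k j) + ?w (Y_entry i k) \<le> 6"
      if "k \<noteq> i" "k \<noteq> j"
      using that entry_weight_bounds(1,2)[of i k n] entry_weight_bounds(1,2)[of k j n] by auto
    show ?thesis
      using m
    proof
      assume P: "m = XY_monomial i k k j"
      consider "k = i" | "k = j" | "k \<noteq> i" "k \<noteq> j"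
        by blast
      then show ?thesis
        using 4 off P unfolding L by cases simp_all
    next
      assume Q: "m = XY_monomial k j i k"
      then have "k \<noteq> j"
        using neq' 4 by auto
      then consider "k = i" | "k \<noteq> i" "k \<noteq> j"
        by blast
      then show ?thesis
        using 4 off Q unfolding L by cases simp_all
    qed
  qed
qed

lemma commutator_leading_terms:
  assumes "n \<ge> 3"
  shows "coprime_leading_terms (entries n) (equations n)
    (generic_entry n :: nat \<times> nat \<Rightarrow> (entry, 'k::field) mpoly) (lead_X n) (lead_Y n) (entry_weight n)"
proof
  show "finite (entries n)" "finite (equations n)"
    by (simp_all add: finite_entries)
  show "inj_on (lead_X n) (equations n)" "inj_on (lead_Y n) (equations n)"
    using assms by (auto simp: inj_on_def equations_iff split: if_splits)
  have "lead_X n e \<noteq> lead_Y n e'" for e e'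
    by (cases e; cases e') auto
  then show "lead_X n ` equations n \<inter> lead_Y n ` equations n = {}"
    by blast
next
  fix e assume e: "e \<in> equations n"
  obtain i j where ij: "e = (i, j)"
    by (cases e)
  have bounds: "i < n" "j < n"
    using e unfolding ij equations_iff by auto
  show "lead_X n e \<in> entries n" "lead_Y n e \<in> entries n"
    using assms bounds unfolding ij by auto
  show "generic_entry n e \<in> carrier (poly_ring (entries n) :: (entry, 'k) mpoly ring)"
    using bounds unfolding ij by (intro generic_entry_carrier) auto
  show "deg_le 2 (generic_entry n e :: (entry, 'k) mpoly)"
    unfolding deg_le_def by (auto elim!: keys_generic_entry)
  define L :: "entry \<Rightarrow>\<^sub>0 nat" where
    "L = Poly_Mapping.single (lead_X n e) 1 + Poly_Mapping.single (lead_Y n e) 1"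
  have "\<exists>k\<in>summands n (i, j). L = XY_monomial i k k j \<or> L = XY_monomial k j i k"
  proof (cases "i = j")
    case True
    then show ?thesis
      using assms bounds e unfolding L_def ij equations_iff lead_monomial
      by (intro bexI[of _ "if i = n - 1 then 1 else 0"]) (auto simp: summands_def)
  next
    case False
    then show ?thesis
      using bounds unfolding L_def ij lead_monomial
      by (intro bexI[of _ "if i < j then i else j"]) (auto simp: summands_def)
  qed
  then have "Poly_Mapping.lookup (generic_entry n e :: (entry, 'k) mpoly) L = 1 \<or>
      Poly_Mapping.lookup (generic_entry n e :: (entry, 'k) mpoly) L = - 1"
    unfolding ij using lookup_generic_entry[where n = n and i = i and j = j and 'k = 'k] by metis
  then show "Poly_Mapping.lookup (generic_entry n e :: (entry, 'k) mpoly)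
      (Poly_Mapping.single (lead_X n e) 1 + Poly_Mapping.single (lead_Y n e) 1) \<noteq> 0"
    unfolding L_def by auto
  fix m assume m: "m \<in> Poly_Mapping.keys (generic_entry n e :: (entry, 'k) mpoly)"
    and neq: "m \<noteq> Poly_Mapping.single (lead_X n e) 1 + Poly_Mapping.single (lead_Y n e) 1"
  obtain k where "k \<in> summands n (i, j)" "m = XY_monomial i k k j \<or> m = XY_monomial k j i k"
    using keys_generic_entry[OF m] unfolding ij by auto
  then show "weight (entry_weight n) m < entry_weight n (lead_X n e) + entry_weight n (lead_Y n e)"
    using lead_monomial_heaviest[OF assms] e neq unfolding ij by blast
qed

section \<open>The commutator with a cyclic permutation matrix\<close>

definition succ_mod :: "nat \<Rightarrow> nat \<Rightarrow> nat" where
  "succ_mod n i = (if i = n - 1 then 0 else Suc i)"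

definition pred_mod :: "nat \<Rightarrow> nat \<Rightarrow> nat" where
  "pred_mod n i = (if i = 0 then n - 1 else i - 1)"

lemma succ_mod_less: "i < n \<Longrightarrow> succ_mod n i < n"
  by (auto simp: succ_mod_def)

lemma pred_mod_less: "i < n \<Longrightarrow> pred_mod n i < n"
  by (auto simp: pred_mod_def)

lemma succ_mod_eq_iff: "i < n \<Longrightarrow> j < n \<Longrightarrow> j = succ_mod n i \<longleftrightarrow> i = pred_mod n j"
  by (auto simp: succ_mod_def pred_mod_def)

lemma inj_succ_mod: "inj_on (succ_mod n) {..<n}"
  by (auto simp: inj_on_def succ_mod_def split: if_splits)

definition cyclic :: "nat \<Rightarrow> nat \<Rightarrow> nat \<Rightarrow> 'a::zero_neq_one" where
  "cyclic n i j = (if j = succ_mod n i then 1 else 0)"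

lemma commutator_entry_cyclic:
  assumes "i < n" "j < n"
  shows "commutator_entry n (cyclic n) y (i, j) = y (succ_mod n i) j - y i (pred_mod n j)"
proof -
  have "(\<Sum>k<n. cyclic n i k * y k j) = (\<Sum>k<n. if k = succ_mod n i then y k j else 0)"
    by (rule sum.cong) (auto simp: cyclic_def)
  also have "\<dots> = y (succ_mod n i) j"
    using assms succ_mod_less[of i n] by simp
  finally have 1: "(\<Sum>k<n. cyclic n i k * y k j) = y (succ_mod n i) j" .
  have "(\<Sum>k<n. y i k * cyclic n k j) = (\<Sum>k<n. if k = pred_mod n j then y i k else 0)"
    by (rule sum.cong) (use assms in \<open>auto simp: cyclic_def succ_mod_eq_iff\<close>)
  also have "\<dots> = y i (pred_mod n j)"
    using assms pred_mod_less[of j n] by simp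
  finally have "(\<Sum>k<n. y i k * cyclic n k j) = y i (pred_mod n j)" .
  with 1 show ?thesis
    by (simp add: commutator_entry_def sum_subtractf)
qed

text \<open>The commutator of the cyclic permutation matrix with \<open>Y\<close> has \<open>y\<^bsub>i+1,j\<^esub> - y\<^bsub>i,j-1\<^esub>\<close> at \<open>(i, j)\<close>, with
  indices modulo \<open>n\<close>. The entry \<open>y\<^bsub>i+1,j\<^esub>\<close> is the unknown for which this equation is solved.\<close>

definition pivots :: "nat \<Rightarrow> (nat \<times> nat) set" where
  "pivots n = (\<lambda>(i, j). (succ_mod n i, j)) ` equations n"

lemma pivot_inj: "inj_on (\<lambda>(i, j). (succ_mod n i, j)) (equations n)"
  using inj_succ_mod[of n] by (auto simp: inj_on_def equations_iff)

lemma succ_pivot_iff: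
  assumes "i < n" "j < n"
  shows "(succ_mod n i, j) \<in> pivots n \<longleftrightarrow> (i, j) \<in> equations n"
proof
  assume "(succ_mod n i, j) \<in> pivots n"
  then obtain i' where "(i', j) \<in> equations n" "succ_mod n i' = succ_mod n i"
    by (auto simp: pivots_def)
  then show "(i, j) \<in> equations n"
    using inj_succ_mod[of n] assms by (auto simp: inj_on_def equations_iff)
qed (force simp: pivots_def)

lemma pivots_less: "(i, j) \<in> pivots n \<Longrightarrow> i < n \<and> j < n"
  by (auto simp: pivots_def equations_iff succ_mod_less)

text \<open>With \<open>t\<^bsub>i,j\<^esub> = y\<^bsub>i+1,j\<^esub>\<close> the equations read \<open>t\<^bsub>i,j\<^esub> = t\<^bsub>i-1,j-1\<^esub>\<close> for \<open>(i, j)\<close> in \<open>equations n\<close>, and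
  \<open>t\<close> is zero elsewhere. On the main diagonal one descends to the missing position \<open>(0, 0)\<close>. From the
  rest of the anti-diagonal, where \<open>i + j = n - 1\<close>, a single step leads to a position off the main
  diagonal whose sum is \<open>n - 3\<close> modulo \<open>n\<close>; this is not \<open>n - 1\<close> modulo \<open>n\<close> as \<open>n \<ge> 3\<close>, so there is no equation
  for it.\<close>

lemma cyclic_kernel:
  fixes y :: "nat \<Rightarrow> nat \<Rightarrow> 'a::comm_ring_1"
  assumes "n \<ge> 3"
    and support: "\<And>i j. i < n \<Longrightarrow> j < n \<Longrightarrow> (i, j) \<notin> pivots n \<Longrightarrow> y i j = 0"
    and eqs: "\<And>e. e \<in> equations n \<Longrightarrow> commutator_entry n (cyclic n) y e = 0"
    and "(i, j) \<in> equations n"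
  shows "y (succ_mod n i) j = 0"
proof -
  have step: "y (succ_mod n i) j = y i (pred_mod n j)" if "(i, j) \<in> equations n" for i j
    using eqs[OF that] that by (simp add: commutator_entry_cyclic equations_iff)
  show ?thesis
  proof (cases "i = j")
    case True
    have "y (succ_mod n i) i = 0" if "i < n" for i
      using that
    proof (induction i)
      case 0
      then show ?case
        using assms(1) succ_mod_less[of 0 n] by (intro support) (simp_all add: succ_pivot_iff equations_iff)
    next
      case (Suc i)
      have "y (succ_mod n (Suc i)) (Suc i) = y (Suc i) (pred_mod n (Suc i))"
        using Suc.prems by (intro step) (simp add: equations_iff)
      also have "\<dots> = y (succ_mod n i) i"
        using Suc.prems by (auto simp: pred_mod_def succ_mod_def)
      finally show ?case
        using Suc by simp
    qed
    then show ?thesis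
      using True assms(4) by (simp add: equations_iff)
  next
    case False
    then have ij: "i < n" "j < n" "i + j = n - 1"
      using assms(4) by (auto simp: equations_iff)
    have "(pred_mod n i, pred_mod n j) \<notin> equations n"
      using ij False assms(1) by (auto simp: equations_iff pred_mod_def)
    moreover have "i = succ_mod n (pred_mod n i)"
      using ij succ_mod_eq_iff[of "pred_mod n i" n i] pred_mod_less[of i n] by simp
    ultimately have "(i, pred_mod n j) \<notin> pivots n"
      using ij pred_mod_less succ_pivot_iff by metis
    then have "y i (pred_mod n j) = 0"
      using ij pred_mod_less[of j n] by (intro support) auto
    then show ?thesis
      using step[OF assms(4)] by simp
  qed
qed

definition unit_matrix :: "nat \<times> nat \<Rightarrow> nat \<Rightarrow> nat \<Rightarrow> 'a::zero_neq_one" where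
  "unit_matrix u k l = (if (k, l) = u then 1 else 0)"

text \<open>The determinant of the system of equations in the pivots, where \<open>X\<close> is the cyclic permutation matrix.\<close>

lemma det_pivots_nonzero:
  fixes es :: "(nat \<times> nat) list"
  assumes "n \<ge> 3" and es: "distinct es" "set es = equations n" and r: "r = length es"
  shows "det (mat r r (\<lambda>(s, t). commutator_entry n (cyclic n)
    (unit_matrix (succ_mod n (fst (es ! t)), snd (es ! t))) (es ! s)) :: 'a::idom mat) \<noteq> 0"
proof
  let ?u = "\<lambda>t. (succ_mod n (fst (es ! t)), snd (es ! t))"
  let ?M = "mat r r (\<lambda>(s, t). commutator_entry n (cyclic n) (unit_matrix (?u t)) (es ! s)) :: 'a mat"
  assume "det ?M = 0"
  then obtain v where v: "v \<in> carrier_vec r" "v \<noteq> 0\<^sub>v r" "?M *\<^sub>v v = 0\<^sub>v r"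
    using det_0_iff_vec_prod_zero[of ?M r] by auto
  define y where "y k l = (\<Sum>t<r. v $ t * unit_matrix (?u t) k l)" for k l
  have u_eq: "?u s = ?u t \<longleftrightarrow> s = t" if "s < r" "t < r" for s t
  proof
    assume eq: "?u s = ?u t"
    have "es ! s \<in> equations n" "es ! t \<in> equations n"
      using that es(2) r nth_mem by blast+
    moreover have "(\<lambda>(i, j). (succ_mod n i, j)) (es ! s) = (\<lambda>(i, j). (succ_mod n i, j)) (es ! t)"
      using eq by (simp add: case_prod_unfold)
    ultimately have "es ! s = es ! t"
      using inj_onD[OF pivot_inj[of n], of "es ! s" "es ! t"] by blast
    then show "s = t"
      using that es(1) r by (simp add: nth_eq_iff_index_eq)
  qed simp
  have y_u: "y (succ_mod n (fst (es ! s))) (snd (es ! s)) = v $ s" if "s < r" for s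
  proof -
    have "y (succ_mod n (fst (es ! s))) (snd (es ! s)) = (\<Sum>t<r. if t = s then v $ t else 0)"
      unfolding y_def unit_matrix_def by (rule sum.cong) (use u_eq[OF that] in auto)
    then show ?thesis
      using that by simp
  qed
  have support: "y k l = 0" if "(k, l) \<notin> pivots n" for k l
  proof -
    have "?u t \<in> pivots n" if "t < r" for t
      using es(2) r that nth_mem[of t es] by (force simp: pivots_def)
    then show ?thesis
      using that unfolding y_def unit_matrix_def by (intro sum.neutral) auto
  qed
  have "commutator_entry n (cyclic n) y e = 0" if e: "e \<in> equations n" for e
  proof -
    obtain s where s: "s < r" "es ! s = e"
      using e es(2) r by (metis in_set_conv_nth)
    have "commutator_entry n (cyclic n) y e =
        (\<Sum>t<r. v $ t * commutator_entry n (cyclic n) (unit_matrix (?u t)) e)"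
      unfolding y_def by (simp add: commutator_entry_sum commutator_entry_cmult)
    also have "\<dots> = (?M *\<^sub>v v) $ s"
      using s v(1) by (simp add: scalar_prod_def lessThan_atLeast0 mult.commute)
    finally show ?thesis
      using s v(3) by simp
  qed
  then have "y (succ_mod n i) j = 0" if "(i, j) \<in> equations n" for i j
    using cyclic_kernel[OF assms(1) _ _ that, of y] support by blast
  then have "v $ s = 0" if "s < r" for s
    using y_u[OF that] es(2) r that nth_mem[of s es] by (metis prod.collapse)
  then have "v = 0\<^sub>v r"
    using v(1) by (intro eq_vecI) auto
  then show False
    using v(2) by blast
qed

section \<open>Dimension and regularity\<close>

text \<open>The generators are linear in \<open>Y\<close>. Take the entries of \<open>X\<close> and the entries of \<open>Y\<close> that are not pivots as
  parameters, and solve for the pivots by Cramer's rule. The determinant \<open>D\<close> of the system is a polynomial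
  in the entries of \<open>X\<close>. Multiplying the whole of \<open>Y\<close> by \<open>D\<close>, which is harmless because the equations are
  homogeneous in \<open>Y\<close>, makes the solution a polynomial map. The point at which the parameters are fixed is
  the cyclic permutation matrix together with \<open>Y = 0\<close>, and \<open>D\<close> is not zero there.\<close>

theorem krull_dim_commutator_ge:
  fixes I :: "(entry, 'k::field) mpoly set"
  assumes "n \<ge> 3" and I: "I = Idl\<^bsub>poly_ring (entries n)\<^esub> (generic_entry n ` equations n)"
  shows "enat (2 * n\<^sup>2 - card (equations n)) \<le> krull_dim (poly_ring (entries n) Quot I)"
proof -
  let ?R = "poly_ring (entries n) :: (entry, 'k) mpoly ring"
  obtain es where es: "distinct es" "set es = equations n"
    using finite_distinct_list[OF finite_equations] by metis
  define r where "r = length es"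
  define u where "u t = (succ_mod n (fst (es ! t)), snd (es ! t))" for t
  define x :: "nat \<Rightarrow> nat \<Rightarrow> (entry, 'k) mpoly" where "x i j = indet (X_entry i j)" for i j
  define y0 :: "nat \<Rightarrow> nat \<Rightarrow> (entry, 'k) mpoly" where
    "y0 i j = (if (i, j) \<in> pivots n then 0 else indet (Y_entry i j))" for i j
  define M where "M = mat r r (\<lambda>(s, t). commutator_entry n x (unit_matrix (u t)) (es ! s))"
  define D where "D = det M"
  define g where "g = vec r (\<lambda>s. commutator_entry n x y0 (es ! s))"
  define z where "z = adj_mat M *\<^sub>v g"
  \<comment> \<open>The vector \<open>- z\<close> is the solution for the pivots when the other entries of \<open>Y\<close> are \<open>D\<close> times the parameters.\<close>
  define y where "y i j = D * y0 i j + (\<Sum>t<r. (- z $ t) * unit_matrix (u t) i j)" for i j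
  define \<Xi> where "\<Xi> v = (case v of X_entry i j \<Rightarrow> x i j | Y_entry i j \<Rightarrow> y i j)" for v
  define p :: "entry \<Rightarrow> 'k" where "p v = (case v of X_entry i j \<Rightarrow> cyclic n i j | Y_entry i j \<Rightarrow> 0)" for v
  define Z where "Z = entries n - case_prod Y_entry ` pivots n"
  have u_pivot: "u t \<in> pivots n" if "t < r" for t
    using es(2) r_def that nth_mem[of t es] by (force simp: pivots_def u_def)
  have M: "M \<in> carrier_mat r r" and g: "g \<in> carrier_vec r"
    by (simp_all add: M_def g_def)
  note adj = adj_mat[OF M]
  have Mz: "M *\<^sub>v z = D \<cdot>\<^sub>v g"
  proof -
    have "M *\<^sub>v z = (M * adj_mat M) *\<^sub>v g"
      unfolding z_def using M adj(1) g by (simp add: assoc_mult_mat_vec)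
    also have "\<dots> = D \<cdot>\<^sub>v g"
      unfolding adj(2) D_def using g
      by (intro eq_vecI) (simp_all add: scalar_prod_smult_left)
    finally show ?thesis .
  qed
  have z: "z \<in> carrier_vec r"
    unfolding z_def using adj(1) g by simp
  have solves: "commutator_entry n x y (es ! s) = 0" if s: "s < r" for s
  proof -
    have "commutator_entry n x y (es ! s) = D * commutator_entry n x y0 (es ! s) +
        (\<Sum>t<r. (- z $ t) * commutator_entry n x (unit_matrix (u t)) (es ! s))"
      unfolding y_def by (simp only: commutator_entry_add commutator_entry_cmult commutator_entry_sum)
    also have "(\<Sum>t<r. (- z $ t) * commutator_entry n x (unit_matrix (u t)) (es ! s)) = - (M *\<^sub>v z) $ s"
      using s z by (simp add: M_def scalar_prod_def lessThan_atLeast0 mult.commute sum_negf)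
    finally show ?thesis
      using s unfolding Mz by (simp add: g_def)
  qed
  have gens: "generic_entry n ` equations n \<subseteq> carrier ?R"
    by (auto intro!: generic_entry_carrier simp: equations_iff)
  have "generic_entry n ` equations n \<subseteq> {h \<in> carrier ?R. subst \<Xi> h = 0}"
  proof
    fix h :: "(entry, 'k) mpoly" assume h: "h \<in> generic_entry n ` equations n"
    then obtain s where s: "s < r" "h = generic_entry n (es ! s)"
      using es(2) unfolding r_def by (metis imageE in_set_conv_nth)
    have "subst \<Xi> h = commutator_entry n x y (es ! s)"
      unfolding s generic_entry_def subst_commutator_entry by (simp add: \<Xi>_def)
    then show "h \<in> {h \<in> carrier ?R. subst \<Xi> h = 0}"
      using solves[OF s(1)] gens h by auto
  qed
  then have "I \<subseteq> {h \<in> carrier ?R. subst \<Xi> h = 0}"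
    unfolding I by (rule ring.genideal_minimal[OF poly_ring_ring kernel_subst_ideal])
  then have kills: "subst \<Xi> h = 0" if "h \<in> I" for h
    using that by blast
  have D: "subst (\<lambda>v. const (p v)) D \<noteq> (0 :: (nat, 'k) mpoly)"
  proof -
    let ?\<phi> = "\<lambda>v. const (p v) :: (nat, 'k) mpoly"
    interpret h: comm_ring_hom "subst ?\<phi>"
      by (rule subst_comm_ring_hom)
    have "map_mat (subst ?\<phi>) M = mat r r (\<lambda>(s, t). commutator_entry n (cyclic n) (unit_matrix (u t)) (es ! s))"
    proof (rule eq_matI)
      fix s t assume "s < dim_row (mat r r (\<lambda>(s, t). commutator_entry n (cyclic n) (unit_matrix (u t)) (es ! s)) :: (nat, 'k) mpoly mat)"
        "t < dim_col (mat r r (\<lambda>(s, t). commutator_entry n (cyclic n) (unit_matrix (u t)) (es ! s)) :: (nat, 'k) mpoly mat)"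
      moreover have "(\<lambda>i j. subst ?\<phi> (x i j)) = cyclic n"
        by (intro ext) (simp add: x_def p_def cyclic_def)
      moreover have "(\<lambda>i j. subst ?\<phi> (unit_matrix (u t) i j)) = unit_matrix (u t)"
        by (intro ext) (simp add: unit_matrix_def)
      ultimately show "map_mat (subst ?\<phi>) M $$ (s, t) =
          mat r r (\<lambda>(s, t). commutator_entry n (cyclic n) (unit_matrix (u t)) (es ! s)) $$ (s, t)"
        by (simp add: M_def subst_commutator_entry)
    qed (simp_all add: M_def)
    then have "subst ?\<phi> D = det (mat r r (\<lambda>(s, t). commutator_entry n (cyclic n) (unit_matrix (u t)) (es ! s)))"
      unfolding D_def by (simp flip: h.hom_det)
    then show ?thesis
      unfolding u_def using det_pivots_nonzero[OF assms(1) es r_def, where 'a = "(nat, 'k) mpoly"] by simp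
  qed
  have "enat (card Z) \<le> krull_dim (?R Quot I)"
  proof (rule krull_dim_quotient_ge_parametrization[where \<Xi> = \<Xi> and p = p])
    show "ideal I ?R"
      unfolding I by (rule ring.genideal_ideal[OF poly_ring_ring gens])
    show "finite Z"
      by (simp add: Z_def finite_entries)
    show "\<exists>h\<in>carrier ?R. \<exists>c. subst \<Xi> h = c * (indet v - const (p v)) \<and>
        subst (\<lambda>v. const (p v) :: (nat, 'k) mpoly) c \<noteq> 0" if v: "v \<in> Z" for v
    proof (cases v)
      case (X_entry i j)
      then have "subst \<Xi> (indet v - const (p v)) = 1 * (indet v - const (p v))"
        by (simp add: subst_diff \<Xi>_def x_def)
      moreover have "indet v - const (p v) \<in> carrier ?R"
        using v by (intro carrier_diff carrier_indet carrier_const) (simp add: Z_def)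
      ultimately show ?thesis
        by (metis subst_one one_neq_zero)
    next
      case (Y_entry i j)
      then have "(i, j) \<notin> pivots n"
        using v by (force simp: Z_def)
      then have "y i j = D * indet v"
        using u_pivot Y_entry by (auto simp: y_def y0_def unit_matrix_def intro!: sum.neutral)
      then have "subst \<Xi> (indet v) = D * (indet v - const (p v))"
        using Y_entry by (simp add: \<Xi>_def p_def)
      moreover have "indet v \<in> carrier ?R"
        using v by (intro carrier_indet) (simp add: Z_def)
      ultimately show ?thesis
        using D by blast
    qed
  qed (fact kills)
  also have "card Z = 2 * n\<^sup>2 - card (equations n)"
  proof -
    have "case_prod Y_entry ` pivots n \<subseteq> entries n"
      using pivots_less by auto
    moreover have "card (case_prod Y_entry ` pivots n) = card (pivots n)"
      by (rule card_image) (auto simp: inj_on_def)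
    moreover have "card (pivots n) = card (equations n)"
      unfolding pivots_def by (rule card_image[OF pivot_inj])
    ultimately show ?thesis
      unfolding Z_def using finite_entries[of n]
      by (simp add: card_Diff_subset finite_subset card_entries)
  qed
  finally show ?thesis .
qed

theorem theorem2p4:
  fixes n :: nat
    and R :: "(entry, 'k::field) mpoly ring"
    and X Y C :: "(entry, 'k) mpoly mat"
    and I :: "(entry, 'k) mpoly set"
  assumes "n \<ge> 3"
    and "R = poly_ring (entries n)"
    and "X = generic_X n" and "Y = generic_Y n"
    and "C = X * Y - Y * X"
    and "I = Idl\<^bsub>R\<^esub> ({C $$ (i, i) | i. i < n} \<union> {C $$ (i, n - 1 - i) | i. i < n})"
  shows "(\<exists>fs. regular_sequence R fs \<and> I = Idl\<^bsub>R\<^esub> (set fs)) \<and>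
         krull_dim (R Quot I) =
           enat (if odd n then 2 * n\<^sup>2 - 2 * n + 2 else 2 * n\<^sup>2 - 2 * n + 1)"
proof -
  let ?f = "generic_entry n :: nat \<times> nat \<Rightarrow> (entry, 'k) mpoly"
  interpret L: coprime_leading_terms "entries n" "equations n" ?f "lead_X n" "lead_Y n" "entry_weight n"
    by (rule commutator_leading_terms[OF assms(1)])
  have C: "C $$ (i, j) = ?f (i, j)" if "i < n" "j < n" for i j
    using generic_commutator[OF that] assms(3-5) by simp
  have "{C $$ (i, i) | i. i < n} \<union> {C $$ (i, n - 1 - i) | i. i < n} =
      {?f (i, i) | i. i < n} \<union> {?f (i, n - 1 - i) | i. i < n}"
    unfolding setcompr_eq_image using C by (intro arg_cong2[where f = "(\<union>)"] image_cong) auto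
  then have I: "I = Idl\<^bsub>R\<^esub> (?f ` equations n)"
    using assms(1,2,6) equations_generate[of n, OF _ refl, where 'k = 'k] by simp
  obtain es where es: "distinct es" "set es = equations n"
    using finite_distinct_list[OF finite_equations] by metis
  have "regular_sequence R (map ?f es)"
    unfolding assms(2) by (rule L.regular_sequence_map[OF es])
  moreover have "I = Idl\<^bsub>R\<^esub> (set (map ?f es))"
    by (simp add: I es)
  moreover have "krull_dim (R Quot I) = enat (2 * n\<^sup>2 - card (equations n))"
  proof (rule antisym)
    show "krull_dim (R Quot I) \<le> enat (2 * n\<^sup>2 - card (equations n))"
      using L.krull_dim_le by (simp add: I assms(2) L.J_def card_entries)
    show "enat (2 * n\<^sup>2 - card (equations n)) \<le> krull_dim (R Quot I)"
      unfolding assms(2) by (rule krull_dim_commutator_ge[OF assms(1) I[unfolded assms(2)]])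
  qed
  moreover have "2 * n\<^sup>2 - card (equations n) = (if odd n then 2 * n\<^sup>2 - 2 * n + 2 else 2 * n\<^sup>2 - 2 * n + 1)"
  proof -
    have "2 * n \<le> 2 * n\<^sup>2"
      by (simp add: power2_eq_square)
    then show ?thesis
      using assms(1) by (cases "odd n") (simp_all add: card_equations Suc_diff_le)
  qed
  ultimately show ?thesis
    by auto
qed

end
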